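(* Let $\mathbb{F}_q$ be a finite field and let $f_1,\ldots,f_r\in\mathbb{F}_q[x_1,\ldots,x_n]$ be polynomials of total degrees $d_1,\ldots,d_r$, with $d=d_1+\cdots+d_r$. For a subset $S\subseteq\mathbb{A}^n(\mathbb{F}_q)=\mathbb{F}_q^n$ let $\mathcal{N}(S)=\#\{\mathbf{x}\in S: f_1(\mathbf{x})=\cdots=f_r(\mathbf{x})=0\}$. Then for any two parallel affine linear subspaces $L_1,L_2\subseteq\mathbb{A}^n(\mathbb{F}_q)$ of dimension at least $d$ we have \[\mathcal{N}(L_1)\equiv\mathcal{N}(L_2)\pmod{q}.\]
   Context: Affine linear subspaces $L_1,L_2$ of $\mathbb{F}_q^n$ are parallel if one is a translate of the other (they need not pass through the origin). *)

theory Defs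
  imports
    "HOL-Analysis.Analysis"
    "HOL-Library.Poly_Mapping"
    "HOL-Number_Theory.Cong"
begin

text \<open>
  Polynomials over \<^typ>\<open>'a\<close> in variables indexed by \<^typ>\<open>'n\<close>: a finitely supported map
  from exponent vectors to coefficients.
\<close>

type_synonym ('n, 'a) mpoly = "('n \<Rightarrow>\<^sub>0 nat) \<Rightarrow>\<^sub>0 'a"

definition mpoly_eval :: "('n::finite, 'a::comm_semiring_1) mpoly \<Rightarrow> 'a ^ 'n \<Rightarrow> 'a" where
  "mpoly_eval p x =
     (\<Sum>m\<in>Poly_Mapping.keys p.
        Poly_Mapping.lookup p m * (\<Prod>i\<in>UNIV. x $ i ^ Poly_Mapping.lookup m i))"

text \<open>The zero polynomial is given total degree 0.\<close>

definition total_degree :: "('n::finite, 'a::comm_semiring_1) mpoly \<Rightarrow> nat" where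
  "total_degree p =
     Max (insert 0 ((\<lambda>m. \<Sum>i\<in>UNIV. Poly_Mapping.lookup m i) ` Poly_Mapping.keys p))"

text \<open>
  The library's \<^const>\<open>affine\<close>, \<^const>\<open>affine_parallel\<close> and \<^const>\<open>aff_dim\<close> are confined to
  real vector spaces, so the notions are introduced here over an arbitrary field.
\<close>

definition affine_subspace :: "('a::field ^ 'n::finite) set \<Rightarrow> bool" where
  "affine_subspace L \<longleftrightarrow> (\<exists>a V. vec.subspace V \<and> L = (+) a ` V)"

definition direction :: "('a::field ^ 'n::finite) set \<Rightarrow> ('a ^ 'n) set" where
  "direction L = {x - y | x y. x \<in> L \<and> y \<in> L}"

definition affine_dimension :: "('a::field ^ 'n::finite) set \<Rightarrow> nat" where
  "affine_dimension L = vec.dim (direction L)"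

definition parallel :: "('a::field ^ 'n::finite) set \<Rightarrow> ('a ^ 'n) set \<Rightarrow> bool" where
  "parallel L M \<longleftrightarrow> (\<exists>t. M = (+) t ` L)"

definition num_zeros ::
  "nat \<Rightarrow> (nat \<Rightarrow> ('n::finite, 'a::comm_semiring_1) mpoly) \<Rightarrow> ('a ^ 'n) set \<Rightarrow> nat" where
  "num_zeros r f S = card {x \<in> S. \<forall>i\<in>{1..r}. mpoly_eval (f i) x = 0}"

lemma direction_translate:
  assumes "vec.subspace V"
  shows "direction ((+) a ` V) = V"
proof
  show "direction ((+) a ` V) \<subseteq> V"
    using assms by (auto simp: direction_def vec.subspace_diff)
  show "V \<subseteq> direction ((+) a ` V)"
  proof
    fix v assume "v \<in> V"
    moreover have "0 \<in> V"
      using assms by (rule vec.subspace_0)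
    moreover have "v = (a + v) - (a + 0)"
      by simp
    ultimately show "v \<in> direction ((+) a ` V)"
      unfolding direction_def by blast
  qed
qed

end

theory Submission imports Defs begin

text \<open>
  Let \<open>q = p ^ e\<close>. In the monoid ring \<open>R = \<int>[F\<^sub>q]\<close> of the multiplicative monoid of the field, filtered
  \<open>p\<close>-adically after localising at an element \<open>eps\<close> whose negative is idempotent modulo \<open>p\<close>,
  the basis elements \<open>[a]\<close> play the role of Teichmueller representatives. If \<open>F\<close> lifts a polynomial \<open>f\<close>
  termwise, then \<open>1 - F ^ (q * (q - 1))\<close> is modulo \<open>p ^ e\<close> the indicator of \<open>f = 0\<close>. Expanding this by the
  multinomial theorem and summing over all points, only terms survive in which the exponent of every
  variable is a positive multiple of \<open>q - 1\<close>. Legendre's formula and a count of base-\<open>p\<close> digits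
  (Ax's argument) show that when the number of variables is at least \<open>d\<close>, the multinomial coefficients
  of such a term are divisible by \<open>p ^ e\<close> as soon as it involves a monomial of \<open>f\<^sub>l\<close> of
  degree less than \<open>d\<^sub>l\<close>. Hence the number of zeros modulo \<open>q\<close> depends only on the
  coefficients in top degree, and these do not change under translation.
\<close>

subsection \<open>Digits and multinomial coefficients\<close>

definition digit_sum :: "nat \<Rightarrow> nat \<Rightarrow> nat \<Rightarrow> nat" where
  "digit_sum p J k = (\<Sum>i<J. k div p ^ i mod p)"

text \<open>
  The digits of \<open>k\<close> in base \<open>p\<close>, rotated cyclically by \<open>j\<close> places in blocks of length \<open>e\<close>; this represents
  \<open>p ^ j * k\<close> modulo \<open>p ^ e - 1\<close> without changing the digit sum.
\<close>

definition digit_weight :: "nat \<Rightarrow> nat \<Rightarrow> nat \<Rightarrow> nat \<Rightarrow> nat \<Rightarrow> nat" where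
  "digit_weight p e J j k = (\<Sum>i<J. (k div p ^ i mod p) * p ^ ((i + j) mod e))"

lemma digit_expansion: "(\<Sum>i<J. (k div p ^ i mod p) * p ^ i) = k mod p ^ J" for k p :: nat
proof (induction J)
  case (Suc J)
  then show ?case using mod_mult2_eq[of k "p ^ J" p] by (simp add: mult.commute)
qed simp

text \<open>Since \<open>p ^ e\<close> is 1 modulo \<open>p ^ e - 1\<close>, exponents of
  \<open>p\<close> may be reduced modulo \<open>e\<close>.\<close>

lemma digit_weight_cong:
  assumes "p > 0" "k < p ^ J"
  shows "[digit_weight p e J j k = p ^ j * k] (mod (p ^ e - 1))"
proof -
  have 1: "[p ^ e = 1] (mod (p ^ e - 1))"
  proof -
    have "p ^ e = 1 + (p ^ e - 1)" using assms(1) by (simp add: Suc_leI)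
    then show ?thesis by (metis cong_add_rcancel_0 cong_refl cong_add_lcancel_0_nat cong_to_1_nat add_diff_cancel_left' dvd_refl cong_altdef_nat le_add1)
  qed
  have 2: "[p ^ (m mod e) = p ^ m] (mod (p ^ e - 1))" for m
  proof -
    have "p ^ m = (p ^ e) ^ (m div e) * p ^ (m mod e)"
      by (metis div_mult_mod_eq mult.commute power_add power_mult)
    moreover have "[(p ^ e) ^ (m div e) * p ^ (m mod e) = 1 ^ (m div e) * p ^ (m mod e)] (mod (p ^ e - 1))"
      by (intro cong_mult cong_pow 1 cong_refl)
    ultimately show ?thesis by (simp add: cong_sym)
  qed
  have "[digit_weight p e J j k = (\<Sum>i<J. (k div p ^ i mod p) * p ^ (i + j))] (mod (p ^ e - 1))"
    unfolding digit_weight_def by (intro cong_sum cong_mult cong_refl 2)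
  also have "(\<Sum>i<J. (k div p ^ i mod p) * p ^ (i + j)) = p ^ j * k"
  proof -
    have "p ^ j * k = p ^ j * (\<Sum>i<J. (k div p ^ i mod p) * p ^ i)"
      using digit_expansion[of k p J] assms by simp
    then show ?thesis by (simp add: power_add sum_distrib_left mult_ac)
  qed
  finally show ?thesis .
qed

lemma digit_weight_pos:
  assumes "p > 0" "k < p ^ J" "k > 0"
  shows "digit_weight p e J j k > 0"
proof (rule ccontr)
  assume "\<not> ?thesis"
  then have "\<forall>i<J. k div p ^ i mod p = 0" using assms(1) by (auto simp: digit_weight_def)
  then have "(\<Sum>i<J. (k div p ^ i mod p) * p ^ i) = 0" by simp
  then show False using digit_expansion[of k p J] assms by simp
qed

lemma sum_rotate:
  fixes g :: "nat \<Rightarrow> 'b::comm_monoid_add"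
  assumes "e > 0"
  shows "(\<Sum>j<e. g ((i + j) mod e)) = (\<Sum>j<e. g j)"
proof (rule sum.reindex_bij_betw)
  have "inj_on (\<lambda>j. (i + j) mod e) {..<e}"
  proof (rule inj_onI)
    fix x y assume "x \<in> {..<e}" "y \<in> {..<e}" "(i + x) mod e = (i + y) mod e"
    then have "[i + x = i + y] (mod e)" by (simp add: cong_def)
    then have "[x = y] (mod e)" using cong_add_lcancel_nat by blast
    then show "x = y" using \<open>x \<in> _\<close> \<open>y \<in> _\<close> by (simp add: cong_def)
  qed
  moreover have "(\<lambda>j. (i + j) mod e) ` {..<e} \<subseteq> {..<e}" using assms by auto
  ultimately show "bij_betw (\<lambda>j. (i + j) mod e) {..<e} {..<e}"
    by (simp add: bij_betw_def endo_inj_surj)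
qed

text \<open>Over the \<open>e\<close> rotations every digit visits each of the places 0 to
  \<open>e - 1\<close> once, which multiplies it by the geometric sum
  \<open>(p ^ e - 1) / (p - 1)\<close>.\<close>

lemma sum_digit_weight:
  assumes "p > 0" "e > 0"
  shows "(p - 1) * (\<Sum>j<e. digit_weight p e J j k) = (p ^ e - 1) * digit_sum p J k"
proof -
  have geo: "(p - 1) * (\<Sum>j<e. p ^ j) = p ^ e - 1"
  proof -
    have "int ((p - 1) * (\<Sum>j<e. p ^ j)) = int (p ^ e - 1)"
      using power_diff_1_eq[of "int p" e] assms by (simp add: of_nat_diff Suc_leI)
    then show ?thesis by presburger
  qed
  have "(\<Sum>j<e. digit_weight p e J j k) = (\<Sum>i<J. (k div p ^ i mod p) * (\<Sum>j<e. p ^ ((i + j) mod e)))"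
    unfolding digit_weight_def by (subst sum.swap) (simp add: sum_distrib_left)
  also have "\<dots> = digit_sum p J k * (\<Sum>j<e. p ^ j)"
    unfolding sum_rotate[OF assms(2), where g = "\<lambda>j. p ^ j"] digit_sum_def by (simp add: sum_distrib_right)
  finally show ?thesis using geo by (metis mult.assoc mult.commute)
qed

section \<open>Legendre's formula in terms of digit sums\<close>

lemma digit_sum_telescope:
  assumes "p > 0"
  shows "digit_sum p J n + (p - 1) * (\<Sum>j\<in>{1..J}. n div p ^ j) + n div p ^ J = n"
proof (induction J)
  case (Suc J)
  have "n div p ^ J = p * (n div p ^ Suc J) + n div p ^ J mod p"
    by (metis div_mult2_eq mult_div_mod_eq power_Suc2)
  moreover have "p * x = (p - 1) * x + x" for x using assms by (cases p) auto
  ultimately show ?case using Suc by (simp add: digit_sum_def distrib_left)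
qed (simp add: digit_sum_def)

lemma multiplicity_eq_card:
  fixes p :: nat
  assumes "prime p" "0 < m" "m < p ^ J"
  shows "multiplicity p m = card {j\<in>{1..J}. p ^ j dvd m}"
proof -
  have ne: "m \<noteq> 0" "\<not> is_unit p" using assms by auto
  have "j \<le> J" if "p ^ j dvd m" for j
    using that assms by (metis dvd_imp_le leD linorder_le_cases order.strict_trans1 prime_gt_1_nat power_increasing_iff)
  then have "j \<le> J" if "j \<le> multiplicity p m" for j
    using that multiplicity_dvd' by blast
  moreover have "p ^ j dvd m \<longleftrightarrow> j \<le> multiplicity p m" for j
    using power_dvd_iff_le_multiplicity ne by blast
  ultimately have "{j\<in>{1..J}. p ^ j dvd m} = {1..multiplicity p m}" by auto
  then show ?thesis by simp
qed

text \<open>Passing from \<open>n\<close> to \<open>Suc n\<close>, the quotient by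
  \<open>p ^ j\<close> grows by one exactly when \<open>p ^ j\<close> divides \<open>Suc n\<close>,
  so the sum grows by the multiplicity of \<open>p\<close> in \<open>Suc n\<close>.\<close>

lemma multiplicity_fact_aux:
  assumes "prime p" "n < p ^ J"
  shows "multiplicity p (fact n :: nat) = (\<Sum>j\<in>{1..J}. n div p ^ j)"
  using assms(2)
proof (induction n)
  case (Suc n)
  have "(\<Sum>j\<in>{1..J}. Suc n div p ^ j) = (\<Sum>j\<in>{1..J}. n div p ^ j + (if p ^ j dvd Suc n then 1 else 0))"
    by (rule sum.cong) (auto simp: div_Suc mod_eq_0_iff_dvd)
  also have "\<dots> = (\<Sum>j\<in>{1..J}. n div p ^ j) + card {j\<in>{1..J}. p ^ j dvd Suc n}"
    by (simp add: sum.distrib sum.If_cases Int_def)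
  finally show ?case
    using Suc multiplicity_eq_card[OF assms(1), of "Suc n" J] assms(1)
    by (simp add: prime_elem_multiplicity_mult_distrib del: mult_Suc)
qed simp

lemma legendre_formula:
  assumes "prime p" "n < p ^ J"
  shows "(p - 1) * multiplicity p (fact n :: nat) + digit_sum p J n = n"
  using digit_sum_telescope[of p J n] multiplicity_fact_aux[OF assms] assms
  by (simp add: prime_gt_0_nat)

text \<open>The factor \<open>p ^ N\<close> only shifts the digits of \<open>m\<close>, so at most
  \<open>e\<close> places are nonzero. Applied below to \<open>q * (q - 1)\<close>.\<close>

lemma digit_sum_le:
  assumes "p > 0" "m < p ^ e"
  shows "digit_sum p J (p ^ N * m) \<le> e * (p - 1)"
proof -
  have z: "p ^ N * m div p ^ i mod p = 0" if "i \<notin> {N..<N+e}" for i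
  proof (cases "i < N")
    case True
    then have "p ^ N = p ^ i * (p * p ^ (N - i - 1))"
      by (simp flip: power_add power_Suc)
    then show ?thesis using assms(1) by (simp add: mult.assoc)
  next
    case False
    with that have "N + e \<le> i" by auto
    then have "p ^ N * p ^ e \<le> p ^ i" using assms(1) by (simp add: Suc_leI power_increasing flip: power_add)
    moreover have "p ^ N * m < p ^ N * p ^ e" using assms by simp
    ultimately have "p ^ N * m div p ^ i = 0" by (meson div_less order_less_le_trans)
    then show ?thesis by simp
  qed
  have "digit_sum p J (p ^ N * m) \<le> (\<Sum>i\<in>{N..<N+e} \<union> {..<J}. p ^ N * m div p ^ i mod p)"
    unfolding digit_sum_def by (rule sum_mono2) auto
  also have "\<dots> = (\<Sum>i\<in>{N..<N+e}. p ^ N * m div p ^ i mod p)"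
    by (rule sum.mono_neutral_right) (use z in auto)
  also have "\<dots> \<le> (\<Sum>i\<in>{N..<N+e}. p - 1)"
  proof (rule sum_mono)
    show "p ^ N * m div p ^ i mod p \<le> p - 1" for i
      using mod_less_divisor[OF assms(1), of "p ^ N * m div p ^ i"] by linarith
  qed
  finally show ?thesis by simp
qed

section \<open>Multinomial coefficients and their divisibility by prime powers\<close>

definition multinomial :: "'b set \<Rightarrow> ('b \<Rightarrow> nat) \<Rightarrow> nat" where
  "multinomial A k = fact (sum k A) div (\<Prod>a\<in>A. fact (k a))"

lemma multinomial_cong: "(\<And>a. a \<in> A \<Longrightarrow> k a = k' a) \<Longrightarrow> multinomial A k = multinomial A k'"
  by (simp add: multinomial_def cong: sum.cong prod.cong)

lemma prod_fact_mult_multinomial: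
  assumes "finite A"
  shows "(\<Prod>a\<in>A. fact (k a)) * multinomial A k = (fact (sum k A) :: nat)"
proof -
  have "(\<Prod>a\<in>A. fact (k a)) dvd (fact (sum k A) :: nat)"
    using assms
  proof (induction A rule: finite_induct)
    case (insert b A)
    have "fact (k b) * fact (sum k A) dvd (fact (k b + sum k A) :: nat)" by (rule fact_fact_dvd_fact)
    then show ?case using insert by (simp add: dvd_trans[OF mult_dvd_mono[OF dvd_refl]])
  qed simp
  then show ?thesis by (simp add: multinomial_def)
qed

lemma multinomial_insert:
  assumes "finite A" "b \<notin> A"
  shows "multinomial (insert b A) k = (k b + sum k A choose k b) * multinomial A k"
proof -
  have "(fact (k b) * (\<Prod>a\<in>A. fact (k a))) * multinomial (insert b A) k = fact (k b + sum k A)"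
    using prod_fact_mult_multinomial[of "insert b A" k] assms by simp
  also have "\<dots> = fact (k b) * fact (sum k A) * (k b + sum k A choose k b)"
    using binomial_fact_lemma[of "k b" "k b + sum k A"] by simp
  also have "\<dots> = (fact (k b) * (\<Prod>a\<in>A. fact (k a))) * ((k b + sum k A choose k b) * multinomial A k)"
    using prod_fact_mult_multinomial[OF assms(1), of k] by (metis mult.assoc mult.commute)
  finally show ?thesis using assms(1) by (simp add: prod_zero_iff)
qed

text \<open>Induction, splitting off the summand \<open>b\<close> by the binomial theorem. Exponent
  vectors are \<open>undefined\<close> outside \<open>A\<close>, so that a vector on
  \<open>insert b A\<close> corresponds to exactly one pair of a value at \<open>b\<close> and a
  vector on \<open>A\<close>.\<close>

lemma multinomial_theorem:
  fixes z :: "'b \<Rightarrow> 'c::comm_semiring_1"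
  assumes "finite A"
  shows "(\<Sum>a\<in>A. z a) ^ M =
    (\<Sum>k\<in>{k \<in> A \<rightarrow>\<^sub>E {..M}. sum k A = M}. of_nat (multinomial A k) * (\<Prod>a\<in>A. z a ^ k a))"
  using assms
proof (induction A arbitrary: M rule: finite_induct)
  case empty
  have "{k \<in> {} \<rightarrow>\<^sub>E {..M}. sum k {} = M} = (if M = 0 then {\<lambda>_. undefined} else {})" for M :: nat
    by auto
  then show ?case by (cases M) (auto simp: multinomial_def)
next
  case (insert b A)
  let ?K = "\<lambda>A M. {k \<in> A \<rightarrow>\<^sub>E {..M}. sum k A = M}"
  have fin: "finite (?K A M)" if "finite A" for A :: "'b set" and M :: nat
    by (rule finite_subset[of _ "A \<rightarrow>\<^sub>E {..M}"]) (use that in \<open>auto intro!: finite_PiE\<close>)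
  have upd: "sum (k(b := i)) A = sum k A" for k :: "'b \<Rightarrow> nat" and i
    by (rule sum.cong) (use insert in auto)
  have "(\<Sum>a\<in>insert b A. z a) ^ M = (\<Sum>i\<le>M. of_nat (M choose i) * z b ^ i * (\<Sum>a\<in>A. z a) ^ (M - i))"
    using insert by (simp add: binomial_ring)
  also have "\<dots> = (\<Sum>i\<le>M. \<Sum>k\<in>?K A (M - i). of_nat (M choose i) * z b ^ i * (of_nat (multinomial A k) * (\<Prod>a\<in>A. z a ^ k a)))"
    by (simp add: insert sum_distrib_left)
  also have "\<dots> = (\<Sum>(i,k)\<in>(SIGMA i:{..M}. ?K A (M - i)). of_nat (M choose i) * z b ^ i * (of_nat (multinomial A k) * (\<Prod>a\<in>A. z a ^ k a)))"
    by (rule sum.Sigma) (use fin insert in auto)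
  also have "\<dots> = (\<Sum>k\<in>?K (insert b A) M. of_nat (multinomial (insert b A) k) * (\<Prod>a\<in>insert b A. z a ^ k a))"
  proof (rule sum.reindex_bij_witness[of _ "\<lambda>k. (k b, k(b := undefined))" "\<lambda>(i,k). k(b := i)"])
    fix x assume "x \<in> (SIGMA i:{..M}. ?K A (M - i))"
    then obtain i k where x: "x = (i, k)" "i \<le> M" "k \<in> A \<rightarrow>\<^sub>E {..M - i}" "sum k A = M - i" by auto
    have kb: "k b = undefined" using x(3) insert(2) by (auto simp: PiE_def extensional_def)
    show "(\<lambda>k. (k b, k(b := undefined))) ((\<lambda>(i,k). k(b := i)) x) = x"
      using kb x(1) by auto
    show "(\<lambda>(i,k). k(b := i)) x \<in> ?K (insert b A) M"
      using x insert upd[of k i] by (auto simp: PiE_iff extensional_def)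
    have "multinomial A (k(b := i)) = multinomial A k" "(\<Prod>a\<in>A. z a ^ (k(b := i)) a) = (\<Prod>a\<in>A. z a ^ k a)"
      using insert(2) by (auto intro!: multinomial_cong prod.cong)
    then show "of_nat (multinomial (insert b A) ((\<lambda>(i,k). k(b := i)) x)) * (\<Prod>a\<in>insert b A. z a ^ ((\<lambda>(i,k). k(b := i)) x) a)
      = (case x of (i, k) \<Rightarrow> of_nat (M choose i) * z b ^ i * (of_nat (multinomial A k) * (\<Prod>a\<in>A. z a ^ k a)))"
      using x insert upd[of k i] by (simp add: multinomial_insert mult_ac)
  next
    fix k assume "k \<in> ?K (insert b A) M"
    then have k: "k \<in> insert b A \<rightarrow>\<^sub>E {..M}" "k b + sum k A = M" using insert by auto
    show "(\<lambda>(i,k). k(b := i)) ((\<lambda>k. (k b, k(b := undefined))) k) = k" by simp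
    have "k a \<le> sum k A" if "a \<in> A" for a using that insert(1) by (simp add: member_le_sum)
    then show "(\<lambda>k. (k b, k(b := undefined))) k \<in> (SIGMA i:{..M}. ?K A (M - i))"
      using k insert upd[of k undefined] by (auto simp: PiE_iff extensional_def)
  qed
  finally show ?case .
qed

text \<open>Here \<open>k l a\<close> is the multinomial exponent of the monomial \<open>a\<close>
  of the \<open>l\<close>-th polynomial, and \<open>a i\<close> the exponent of variable
  \<open>i\<close> in it. Rotating digits by \<open>j\<close> places gives the \<open>l\<close>-th
  exponents the total weight \<open>(q - 1) * b l j\<close>. Legendre's formula bounds the
  multiplicity of \<open>p\<close> in the \<open>l\<close>-th coefficient below by the sum of
  \<open>b l j - 1\<close> over \<open>j < e\<close>, and a degree count finds for every
  \<open>j\<close> some \<open>l\<close> with \<open>b l j\<close> at least 2. So each of the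
  \<open>e\<close> rotations contributes a factor \<open>p\<close>.\<close>

lemma prime_power_dvd_prod_multinomial:
  fixes A :: "'l \<Rightarrow> (nat \<Rightarrow> nat) set" and k :: "'l \<Rightarrow> (nat \<Rightarrow> nat) \<Rightarrow> nat"
  assumes p: "prime p" and e: "e > 0" and q: "q = p ^ e"
    and finI: "finite I" and finA: "\<And>l. l \<in> I \<Longrightarrow> finite (A l)"
    and n: "(\<Sum>l\<in>I. D l) \<le> n"
    and tot: "\<And>l. l \<in> I \<Longrightarrow> sum (k l) (A l) \<in> {0, q * (q - 1)}"
    and deg: "\<And>l a. l \<in> I \<Longrightarrow> a \<in> A l \<Longrightarrow> (\<Sum>i<n. a i) \<le> D l"
    and low: "l0 \<in> I" "a0 \<in> A l0" "k l0 a0 > 0" "(\<Sum>i<n. a0 i) < D l0"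
    and expo: "\<And>i. i < n \<Longrightarrow> 0 < (\<Sum>l\<in>I. \<Sum>a\<in>A l. k l a * a i)"
      "\<And>i. i < n \<Longrightarrow> q - 1 dvd (\<Sum>l\<in>I. \<Sum>a\<in>A l. k l a * a i)"
  shows "p ^ e dvd (\<Prod>l\<in>I. multinomial (A l) (k l))"
proof -
  \<comment> \<open>Now \<open>p ^ J\<close> is \<open>q * q\<close>, which exceeds
    \<open>q * (q - 1)\<close> and hence every \<open>k l a\<close>, so no digits are cut
    off.\<close>
  define J where "J = 2 * e"
  define w where "w j m = digit_weight p e J j m" for j m
  define W where "W l j = (\<Sum>a\<in>A l. w j (k l a))" for l j
  define b where "b l j = W l j div (q - 1)" for l j
  define v where "v l = multiplicity p (multinomial (A l) (k l))" for l
  have p1: "p > 1" using p prime_gt_1_nat by blast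
  have q1: "q > 1" unfolding q using p1 e by (intro one_less_power) auto
  have pJ: "p ^ J = q * q" by (simp add: J_def q mult_2 power_add)
  have kle: "k l a \<le> sum (k l) (A l)" if "l \<in> I" "a \<in> A l" for l a
    using that finA by (simp add: member_le_sum)
  have M: "q * (q - 1) < p ^ J" using q1 pJ by simp
  have kJ: "k l a < p ^ J" if "l \<in> I" "a \<in> A l" for l a
    using kle[OF that] tot[OF that(1)] M p1 by (auto simp: q)
  have w0: "w j 0 = 0" for j by (simp add: w_def digit_weight_def)
  have wpos: "w j (k l a) > 0" if "l \<in> I" "a \<in> A l" "k l a > 0" for j l a
    unfolding w_def using that p1 kJ by (intro digit_weight_pos) auto
  have wcong: "[w j (k l a) = p ^ j * k l a] (mod (q - 1))" if "l \<in> I" "a \<in> A l" for j l a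
    unfolding w_def q using that p1 kJ by (intro digit_weight_cong) auto
  have Wdvd: "q - 1 dvd W l j" if "l \<in> I" for l j
  proof -
    have "[W l j = (\<Sum>a\<in>A l. p ^ j * k l a)] (mod (q - 1))"
      unfolding W_def using wcong that by (intro cong_sum) auto
    moreover have "q - 1 dvd (\<Sum>a\<in>A l. p ^ j * k l a)"
      using tot[OF that] by (auto simp flip: sum_distrib_left)
    ultimately show ?thesis using cong_dvd_iff by blast
  qed
  have Wb: "W l j = (q - 1) * b l j" if "l \<in> I" for l j
    using Wdvd[OF that] by (simp add: b_def)
  have nz: "multinomial (A l) (k l) \<noteq> 0" if "l \<in> I" for l
  proof
    assume "multinomial (A l) (k l) = 0"
    then show False using prod_fact_mult_multinomial[OF finA[OF that], of "k l"] by simp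
  qed
  \<comment> \<open>Truncated subtraction covers the case that all exponents of \<open>l\<close>
    vanish, where \<open>b l j = 0\<close>.\<close>
  have bv: "(\<Sum>j<e. b l j - 1) \<le> v l" if l: "l \<in> I" for l
  proof (cases "sum (k l) (A l) = 0")
    case True
    then have "k l a = 0" if "a \<in> A l" for a using finA[OF l] that by simp
    then have "W l j = 0" for j by (simp add: W_def w0)
    then show ?thesis by (simp add: b_def)
  next
    case False
    then have s: "sum (k l) (A l) = q * (q - 1)" using tot[OF l] by simp
    obtain a where a: "a \<in> A l" "k l a > 0" using False by (metis gr0I sum.neutral)
    have Wpos: "W l j > 0" for j
      unfolding W_def using wpos[OF l a] a(1) finA[OF l] by (intro sum_pos2[of _ a]) auto
    have b1: "b l j \<ge> 1" for j using Wb[OF l, of j] Wpos[of j] by (cases "b l j") auto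
    have "multiplicity p (\<Prod>a\<in>A l. fact (k l a) :: nat) = (\<Sum>a\<in>A l. multiplicity p (fact (k l a) :: nat))"
      using p by (subst prime_elem_multiplicity_prod_distrib) (auto simp: finA[OF l])
    moreover have "(\<Prod>a\<in>A l. fact (k l a) :: nat) \<noteq> 0" using finA[OF l] by simp
    ultimately have "multiplicity p (fact (q * (q - 1)) :: nat) = (\<Sum>a\<in>A l. multiplicity p (fact (k l a) :: nat)) + v l"
      unfolding v_def s[symmetric] prod_fact_mult_multinomial[OF finA[OF l], of "k l", symmetric]
      using p nz[OF l] by (subst prime_elem_multiplicity_mult_distrib) auto
    moreover have "(p - 1) * multiplicity p (fact (q * (q - 1)) :: nat) + digit_sum p J (q * (q - 1)) = q * (q - 1)"
      by (rule legendre_formula[OF p M])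
    moreover have "(p - 1) * (\<Sum>a\<in>A l. multiplicity p (fact (k l a) :: nat)) + (\<Sum>a\<in>A l. digit_sum p J (k l a)) = q * (q - 1)"
      unfolding s[symmetric] sum_distrib_left sum.distrib[symmetric]
      using legendre_formula[OF p kJ[OF l]] by (intro sum.cong) auto
    \<comment> \<open>Legendre's formula for the whole and for the parts:
      \<open>(p - 1) * v l\<close> is the excess of the digit sums of the parts over that of the
      whole.\<close>
    ultimately have "(\<Sum>a\<in>A l. digit_sum p J (k l a)) = (p - 1) * v l + digit_sum p J (q * (q - 1))"
      by (simp add: distrib_left)
    moreover have "digit_sum p J (q * (q - 1)) \<le> e * (p - 1)"
      using digit_sum_le[of p "q - 1" e J e] p1 q1 q by simp
    ultimately have *: "(\<Sum>a\<in>A l. digit_sum p J (k l a)) \<le> (p - 1) * (v l + e)"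
      by (simp add: distrib_left mult.commute)
    have "(p - 1) * ((q - 1) * (\<Sum>j<e. b l j)) = (p - 1) * (\<Sum>j<e. W l j)"
      using Wb[OF l] by (simp add: sum_distrib_left)
    also have "\<dots> = (\<Sum>a\<in>A l. (p - 1) * (\<Sum>j<e. w j (k l a)))"
      unfolding W_def by (subst sum.swap) (simp add: sum_distrib_left)
    also have "\<dots> = (\<Sum>a\<in>A l. (q - 1) * digit_sum p J (k l a))"
      unfolding w_def q using p1 e by (intro sum.cong sum_digit_weight) auto
    also have "\<dots> = (q - 1) * (\<Sum>a\<in>A l. digit_sum p J (k l a))"
      by (rule sum_distrib_left[symmetric])
    also have "\<dots> \<le> (q - 1) * ((p - 1) * (v l + e))" using * by (rule mult_le_mono2)
    finally have "(p - 1) * (q - 1) * (\<Sum>j<e. b l j) \<le> (p - 1) * (q - 1) * (v l + e)"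
      by (simp only: mult_ac)
    moreover have "(p - 1) * (q - 1) > 0" using p1 q1 by simp
    ultimately have "(\<Sum>j<e. b l j) \<le> v l + e" by (simp only: mult_le_cancel1)
    moreover have "(\<Sum>j<e. b l j) = (\<Sum>j<e. b l j - 1) + e"
    proof -
      have "(\<Sum>j<e. b l j) = (\<Sum>j<e. (b l j - 1) + 1)" by (simp only: le_add_diff_inverse2[OF b1])
      then show ?thesis unfolding sum.distrib by simp
    qed
    ultimately show ?thesis by simp
  qed
  \<comment> \<open>Ax's argument: for each rotation the reduced exponents still are positive multiples of \<open>q - 1\<close>,
    so that they need more total degree than \<open>\<forall>l. b l j \<le> 1\<close> allows.\<close>
  have big: "\<exists>l\<in>I. b l j \<ge> 2" for j
  proof (rule ccontr)
    assume neg: "\<not> ?thesis"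
    have 1: "q - 1 \<le> (\<Sum>l\<in>I. \<Sum>a\<in>A l. w j (k l a) * a i)" if i: "i < n" for i
    proof -
      have "[(\<Sum>l\<in>I. \<Sum>a\<in>A l. w j (k l a) * a i) = (\<Sum>l\<in>I. \<Sum>a\<in>A l. p ^ j * k l a * a i)] (mod (q - 1))"
        using wcong by (intro cong_sum cong_mult cong_refl) auto
      moreover have "(\<Sum>l\<in>I. \<Sum>a\<in>A l. p ^ j * k l a * a i) = p ^ j * (\<Sum>l\<in>I. \<Sum>a\<in>A l. k l a * a i)"
        by (simp add: sum_distrib_left mult.assoc)
      ultimately have "[(\<Sum>l\<in>I. \<Sum>a\<in>A l. w j (k l a) * a i) = p ^ j * (\<Sum>l\<in>I. \<Sum>a\<in>A l. k l a * a i)] (mod (q - 1))"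
        by (simp only:)
      then have "q - 1 dvd (\<Sum>l\<in>I. \<Sum>a\<in>A l. w j (k l a) * a i)"
        using cong_dvd_iff dvd_mult[OF expo(2)[OF i], of "p ^ j"] by blast
      \<comment> \<open>Rotation keeps positive weights positive, so a rotated exponent vanishes
        only if the original one does.\<close>
      moreover have "(\<Sum>l\<in>I. \<Sum>a\<in>A l. w j (k l a) * a i) \<noteq> 0"
      proof
        assume "(\<Sum>l\<in>I. \<Sum>a\<in>A l. w j (k l a) * a i) = 0"
        then have z: "w j (k l a) * a i = 0" if "l \<in> I" "a \<in> A l" for l a
          using that finI finA by simp
        have "k l a * a i = 0" if "l \<in> I" "a \<in> A l" for l a
          using z[OF that] wpos[OF that, of j] by (cases "k l a = 0") auto
        then have "(\<Sum>l\<in>I. \<Sum>a\<in>A l. k l a * a i) = 0" by (intro sum.neutral ballI)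
        then show False using expo(1)[OF i] by simp
      qed
      ultimately show ?thesis by (simp add: dvd_imp_le)
    qed
    have "n * (q - 1) = (\<Sum>i<n. q - 1)" by simp
    also have "\<dots> \<le> (\<Sum>i<n. \<Sum>l\<in>I. \<Sum>a\<in>A l. w j (k l a) * a i)"
      using 1 by (intro sum_mono) auto
    also have "\<dots> = (\<Sum>l\<in>I. \<Sum>a\<in>A l. w j (k l a) * (\<Sum>i<n. a i))"
      by (subst sum.swap, intro sum.cong refl, subst sum.swap) (simp add: sum_distrib_left)
    also have "\<dots> < (\<Sum>l\<in>I. \<Sum>a\<in>A l. w j (k l a) * D l)"
    proof (rule sum_strict_mono_ex1[OF finI])
      show "\<forall>l\<in>I. (\<Sum>a\<in>A l. w j (k l a) * (\<Sum>i<n. a i)) \<le> (\<Sum>a\<in>A l. w j (k l a) * D l)"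
        using deg by (auto intro!: sum_mono)
      \<comment> \<open>Strictness comes from \<open>a0\<close>, which has positive weight and
        degree below \<open>D l0\<close>.\<close>
      have "(\<Sum>a\<in>A l0. w j (k l0 a) * (\<Sum>i<n. a i)) < (\<Sum>a\<in>A l0. w j (k l0 a) * D l0)"
        using deg[OF low(1)] low wpos[OF low(1,2,3)] finA[OF low(1)]
        by (intro sum_strict_mono_ex1) (auto intro!: bexI[of _ a0])
      then show "\<exists>l\<in>I. (\<Sum>a\<in>A l. w j (k l a) * (\<Sum>i<n. a i)) < (\<Sum>a\<in>A l. w j (k l a) * D l)"
        using low(1) by blast
    qed
    also have "\<dots> = (\<Sum>l\<in>I. W l j * D l)" by (simp add: W_def sum_distrib_right)
    also have "\<dots> \<le> (\<Sum>l\<in>I. (q - 1) * D l)"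
    proof (rule sum_mono)
      fix l assume l: "l \<in> I"
      then have "b l j \<le> 1" using neg by force
      then have "W l j \<le> q - 1" using Wb[OF l, of j] mult_le_mono2[of "b l j" 1 "q - 1"] by simp
      then show "W l j * D l \<le> (q - 1) * D l" by (rule mult_le_mono1)
    qed
    also have "\<dots> \<le> (q - 1) * n" using n by (simp flip: sum_distrib_left)
    finally show False by (simp add: mult.commute)
  qed
  have "e = (\<Sum>j<e. 1)" by simp
  also have "\<dots> \<le> (\<Sum>j<e. \<Sum>l\<in>I. b l j - 1)"
  proof (rule sum_mono)
    fix j
    obtain l where l: "l \<in> I" "b l j \<ge> 2" using big by blast
    have "b l j - 1 \<le> (\<Sum>l\<in>I. b l j - 1)" using l finI by (intro member_le_sum) auto
    then show "1 \<le> (\<Sum>l\<in>I. b l j - 1)" using l by simp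
  qed
  also have "\<dots> = (\<Sum>l\<in>I. \<Sum>j<e. b l j - 1)" by (rule sum.swap)
  also have "\<dots> \<le> (\<Sum>l\<in>I. v l)" using bv by (rule sum_mono)
  also have "\<dots> = multiplicity p (\<Prod>l\<in>I. multinomial (A l) (k l))"
    unfolding v_def using p finI by (subst prime_elem_multiplicity_prod_distrib) (auto dest: nz)
  finally show ?thesis by (rule multiplicity_dvd')
qed

subsection \<open>Finite fields\<close>

text \<open>Multiplication by \<open>x\<close> permutes the nonzero elements; their product is
  compared before and after.\<close>

lemma finite_field_power_card_minus_1:
  fixes x :: "'a::{field,finite}"
  assumes "x \<noteq> 0"
  shows "x ^ (CARD('a) - 1) = 1"
proof -
  have "(\<Prod>y\<in>UNIV-{0}. x * y) = \<Prod>(UNIV - {0::'a})"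
    by (rule prod.reindex_bij_witness[of _ "\<lambda>y. y / x" "\<lambda>y. x * y"]) (use assms in auto)
  then have "x ^ (CARD('a) - 1) * \<Prod>(UNIV - {0::'a}) = \<Prod>(UNIV - {0})"
    by (simp add: prod.distrib)
  then show ?thesis by simp
qed

lemma card_field_gt_1: "CARD('a::{field,finite}) > 1"
  using card_mono[of "UNIV::'a set" "{0,1}"] by simp

lemma finite_field_power_card:
  fixes x :: "'a::{field,finite}"
  shows "x ^ CARD('a) = x"
proof (cases "x = 0")
  case False
  then have "x * x ^ (CARD('a) - 1) = x" using finite_field_power_card_minus_1 by simp
  moreover have "CARD('a) = Suc (CARD('a) - 1)" using card_field_gt_1[where 'a = 'a] by simp
  ultimately show ?thesis by (metis power_Suc)
qed (use card_field_gt_1[where 'a = 'a] in simp)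

text \<open>Otherwise all \<open>q - 1\<close> nonzero elements would be roots of
  \<open>X ^ r - 1\<close>, where the remainder \<open>r\<close> of \<open>k\<close> satisfies
  \<open>0 < r < q - 1\<close>.\<close>

lemma exists_power_neq_1:
  assumes "\<not> CARD('a) - 1 dvd k"
  shows "\<exists>g::'a::{field,finite}. g \<noteq> 0 \<and> g ^ k \<noteq> 1"
proof (rule ccontr)
  assume neg: "\<not> ?thesis"
  define r where "r = k mod (CARD('a) - 1)"
  have q: "CARD('a) - 1 > 0" using card_field_gt_1[where 'a = 'a] by simp
  have r: "0 < r" "r < CARD('a) - 1"
    using assms q by (auto simp: r_def dvd_eq_mod_eq_0)
  have "g ^ r = 1" if "g \<noteq> 0" for g :: 'a
  proof -
    have "g ^ k = (g ^ (CARD('a) - 1)) ^ (k div (CARD('a) - 1)) * g ^ r"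
      unfolding r_def by (metis mult_div_mod_eq power_add power_mult)
    moreover have "g ^ k = 1" using neg that by blast
    ultimately show ?thesis using finite_field_power_card_minus_1[OF that] by simp
  qed
  then have sub: "UNIV - {0::'a} \<subseteq> {x. poly (monom 1 r - 1) x = 0}"
    by (auto simp: poly_monom)
  have "coeff (monom 1 r - 1 :: 'a poly) r = 1" using r by simp
  then have ne: "monom 1 r - 1 \<noteq> (0::'a poly)" by (metis coeff_0 zero_neq_one)
  have "degree (monom 1 r - 1 :: 'a poly) \<le> r"
    by (rule degree_diff_le) (auto simp: degree_monom_le)
  then have "card (UNIV - {0::'a}) \<le> r"
    using card_poly_roots_bound[OF ne] card_mono[OF _ sub] by simp
  then show False using r by simp
qed

lemma sum_powers_eq_0:
  assumes "\<not> CARD('a) - 1 dvd k"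
  shows "(\<Sum>a\<in>UNIV - {0::'a::{field,finite}}. a ^ k) = 0"
proof -
  obtain g :: 'a where g: "g \<noteq> 0" "g ^ k \<noteq> 1" using exists_power_neq_1[OF assms] by blast
  have "(\<Sum>a\<in>UNIV - {0::'a}. (g * a) ^ k) = (\<Sum>a\<in>UNIV - {0::'a}. a ^ k)"
    by (rule sum.reindex_bij_witness[of _ "\<lambda>y. y / g" "\<lambda>y. g * y"]) (use g in auto)
  then have "g ^ k * (\<Sum>a\<in>UNIV - {0::'a}. a ^ k) = (\<Sum>a\<in>UNIV - {0::'a}. a ^ k)"
    by (simp add: power_mult_distrib sum_distrib_left)
  then show ?thesis using g by simp
qed

lemma CHAR_finite_field_prime: "prime CHAR('a::{field,finite})"
  using prime_CHAR_semidom finite_imp_CHAR_pos by (metis finite)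

text \<open>Take \<open>k\<close> maximal such that some additively closed \<open>H\<close>
  containing 0 has \<open>p ^ k\<close> elements. If \<open>x\<close> were outside \<open>H\<close>,
  the sums \<open>c * x + h\<close> with \<open>c < p\<close> would form such a set with
  \<open>p ^ (k + 1)\<close> elements.\<close>

lemma card_field_power_CHAR: "\<exists>e. CARD('a::{field,finite}) = CHAR('a) ^ e"
proof -
  let ?p = "CHAR('a)"
  define P where "P k \<longleftrightarrow> (\<exists>H::'a set. 0 \<in> H \<and> (\<forall>x\<in>H. \<forall>y\<in>H. x + y \<in> H) \<and> card H = ?p ^ k)" for k
  have prime: "prime ?p" by (rule CHAR_finite_field_prime)
  have p0: "of_nat ?p = (0::'a)" by simp
  have "P 0" unfolding P_def by (intro exI[of _ "{0}"]) auto
  moreover have bound: "k \<le> CARD('a)" if "P k" for k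
  proof -
    have "?p ^ k \<le> CARD('a)" using that card_mono unfolding P_def by (metis finite subset_UNIV)
    moreover have "k < ?p ^ k" using prime prime_gt_1_nat by (simp add: power_gt_expt)
    ultimately show ?thesis by simp
  qed
  ultimately obtain k where k: "P k" "\<And>l. P l \<Longrightarrow> l \<le> k"
    using Greatest_le_nat[of P _ "CARD('a)"] GreatestI_nat[of P 0 "CARD('a)"] by blast
  then obtain H :: "'a set" where H: "0 \<in> H" "\<And>x y. x \<in> H \<Longrightarrow> y \<in> H \<Longrightarrow> x + y \<in> H" "card H = ?p ^ k"
    unfolding P_def by blast
  have smult: "of_nat c * x \<in> H" if "x \<in> H" for c x
    using that by (induction c) (auto simp: H distrib_right)
  have diff: "x - y \<in> H" if "x \<in> H" "y \<in> H" for x y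
  proof -
    have "of_nat (?p - 1) * y = - y" using prime prime_gt_0_nat by (simp add: of_nat_diff Suc_leI)
    then show ?thesis using H(2)[OF that(1) smult[OF that(2), of "?p - 1"]] by simp
  qed
  have "H = UNIV"
  proof (rule ccontr)
    assume "H \<noteq> UNIV"
    then obtain x where x: "x \<notin> H" by auto
    let ?f = "\<lambda>(c, h). of_nat c * x + h"
    \<comment> \<open>A nonzero \<open>c < p\<close> is invertible modulo the characteristic, so
      \<open>c * x\<close> in \<open>H\<close> would put \<open>x\<close> into
      \<open>H\<close>.\<close>
    have sm: "c = 0" if "of_nat c * x \<in> H" "c < ?p" for c
    proof (rule ccontr)
      assume "c \<noteq> 0"
      then have "\<not> ?p dvd c" using that(2) nat_dvd_not_less by blast
      then have "coprime c ?p" using prime prime_imp_coprime coprime_commute by blast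
      then obtain c' where "[c * c' = 1] (mod ?p)" using cong_solve_coprime_nat[of c ?p] by auto
      then have "of_nat (c * c') = (1::'a)" using of_nat_eq_iff_cong_CHAR[of "c * c'" 1, where 'a = 'a] by simp
      moreover have "of_nat c' * (of_nat c * x) = of_nat (c * c') * x" by (simp add: mult_ac)
      ultimately have "of_nat c' * (of_nat c * x) = x" by (simp only: mult_1)
      then have "x \<in> H" using smult[OF that(1), of c'] by (rule subst)
      then show False using x by contradiction
    qed
    have aux: "c = c' \<and> h = h'"
      if "c < ?p" "c' < ?p" "h \<in> H" "h' \<in> H" "of_nat c * x + h = of_nat c' * x + h'" "c \<le> c'" for c c' h h'
    proof -
      have "h - h' = (of_nat c * x + h) - (of_nat c * x + h')" by simp
      also have "\<dots> = (of_nat c' * x + h') - (of_nat c * x + h')" by (simp only: that(5))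
      also have "\<dots> = of_nat (c' - c) * x" by (simp add: of_nat_diff[OF that(6)] left_diff_distrib)
      finally have "of_nat (c' - c) * x \<in> H" using diff[OF that(3,4)] by simp
      then have "c' - c = 0" using sm[of "c' - c"] that(2) by simp
      then have "c = c'" using that(6) by simp
      then show ?thesis using that(5) by simp
    qed
    have inj: "inj_on ?f ({..<?p} \<times> H)"
    proof (rule inj_onI)
      fix u v assume uv: "u \<in> {..<?p} \<times> H" "v \<in> {..<?p} \<times> H" "?f u = ?f v"
      obtain c h where u: "u = (c, h)" by (cases u)
      obtain c' h' where v: "v = (c', h')" by (cases v)
      have *: "c < ?p" "h \<in> H" "c' < ?p" "h' \<in> H" "of_nat c * x + h = of_nat c' * x + h'"
        using uv unfolding u v by auto
      have "c = c' \<and> h = h'"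
      proof (cases "c \<le> c'")
        case True
        then show ?thesis using aux[of c c' h h'] * by simp
      next
        case False
        then show ?thesis using aux[of c' c h' h] * by simp
      qed
      then show "u = v" using u v by simp
    qed
    have modp: "of_nat (c mod ?p) = (of_nat c :: 'a)" for c
      by (simp add: of_nat_eq_iff_cong_CHAR cong_def)
    have "P (Suc k)"
      unfolding P_def
    proof (intro exI[of _ "?f ` ({..<?p} \<times> H)"] conjI ballI)
      show "0 \<in> ?f ` ({..<?p} \<times> H)"
        using H prime prime_gt_0_nat by (intro image_eqI[of _ _ "(0, 0)"]) auto
      show "card (?f ` ({..<?p} \<times> H)) = ?p ^ Suc k"
        using card_image[OF inj] H(3) by (simp add: card_cartesian_product)
      fix y z assume "y \<in> ?f ` ({..<?p} \<times> H)" "z \<in> ?f ` ({..<?p} \<times> H)"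
      then obtain c h c' h' where "h \<in> H" "h' \<in> H" "y = of_nat c * x + h" "z = of_nat c' * x + h'" by auto
      moreover have "(c + c') mod ?p < ?p" using prime prime_gt_0_nat by simp
      ultimately show "y + z \<in> ?f ` ({..<?p} \<times> H)"
        using H(2) modp[of "c + c'"]
        by (intro image_eqI[of _ _ "((c + c') mod ?p, h + h')"]) (auto simp: algebra_simps)
    qed
    then show False using k(2) by fastforce
  qed
  then show ?thesis using H(3) by auto
qed

subsection \<open>The monoid ring\<close>

text \<open>
  The library's convolution product on finitely supported functions adds exponents, so the
  multiplicative monoid of the field is wrapped as an additive one.
\<close>

datatype 'a mul = Mul (unmul: 'a)

instantiation mul :: (comm_monoid_mult) comm_monoid_add
begin
definition zero_mul :: "'a mul" where "zero_mul = Mul 1"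
definition plus_mul :: "'a mul \<Rightarrow> 'a mul \<Rightarrow> 'a mul" where "x + y = Mul (unmul x * unmul y)"
instance by standard (auto simp: zero_mul_def plus_mul_def mult_ac)
end

type_synonym 'a monoid_ring = "'a mul \<Rightarrow>\<^sub>0 int"

definition teich :: "'a \<Rightarrow> 'a monoid_ring" where
  "teich a = Poly_Mapping.single (Mul a) 1"

text \<open>The ring homomorphism onto the field that undoes \<open>teich\<close>, which is itself
  multiplicative but not additive.\<close>

definition residue :: "'a::{field,finite} monoid_ring \<Rightarrow> 'a" where
  "residue y = (\<Sum>a\<in>UNIV. of_int (Poly_Mapping.lookup y (Mul a)) * a)"

lemma teich_mult: "teich (a * b) = teich a * teich b" for a b :: "'a::comm_monoid_mult"
  by (simp add: teich_def mult_single plus_mul_def)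

lemma teich_1: "teich (1::'a::comm_monoid_mult) = 1"
  by (simp add: teich_def flip: zero_mul_def)

lemma teich_power: "teich (a ^ k) = teich a ^ k" for a :: "'a::comm_monoid_mult"
  by (induction k) (auto simp: teich_1 teich_mult)

lemma lookup_of_int_mult:
  "Poly_Mapping.lookup (of_int n * y) k = n * Poly_Mapping.lookup y k"
  for y :: "'b::comm_monoid_add \<Rightarrow>\<^sub>0 int"
proof -
  have "of_int n * y = Poly_Mapping.map ((*) n) y"
    unfolding mult_map_scale_conv_mult by (metis of_int_eq_id id_apply single_of_int)
  then show ?thesis by (simp add: map.rep_eq when_def)
qed

lemma monoid_ring_expansion:
  "y = (\<Sum>a\<in>UNIV. of_int (Poly_Mapping.lookup y (Mul a)) * teich a)"
  for y :: "'a::{field,finite} monoid_ring"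
proof (rule poly_mapping_eqI)
  fix k :: "'a mul"
  obtain b where k: "k = Mul b" by (cases k)
  show "Poly_Mapping.lookup y k = Poly_Mapping.lookup (\<Sum>a\<in>UNIV. of_int (Poly_Mapping.lookup y (Mul a)) * teich a) k"
    by (simp add: k lookup_sum lookup_of_int_mult teich_def lookup_single when_def if_distrib cong: if_cong)
qed

lemma residue_add: "residue (x + y) = residue x + residue y"
  by (simp add: residue_def lookup_add distrib_right sum.distrib)

lemma residue_0: "residue 0 = 0"
  by (simp add: residue_def)

lemma residue_sum: "residue (\<Sum>i\<in>I. f i) = (\<Sum>i\<in>I. residue (f i))"
  by (induction I rule: infinite_finite_induct) (auto simp: residue_add residue_0)

lemma residue_of_int_mult: "residue (of_int n * y) = of_int n * residue y"
  by (simp add: residue_def lookup_of_int_mult sum_distrib_left mult.assoc)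

lemma residue_diff: "residue (x - y) = residue x - residue y"
  by (simp add: residue_def lookup_minus left_diff_distrib sum_subtractf)

lemma residue_teich: "residue (teich a) = a"
  by (simp add: residue_def teich_def lookup_single when_def if_distrib[of of_int] if_distrib[of "\<lambda>x. x * _"] cong: if_cong)

lemma residue_mult_teich: "residue (x * teich b) = residue x * b"
proof -
  have "x * teich b = (\<Sum>a\<in>UNIV. of_int (Poly_Mapping.lookup x (Mul a)) * teich (a * b))"
    by (subst monoid_ring_expansion[of x]) (simp add: sum_distrib_right teich_mult mult.assoc)
  then show ?thesis
    by (simp add: residue_sum residue_of_int_mult residue_teich) (simp add: residue_def sum_distrib_right mult.assoc)
qed

lemma residue_mult: "residue (x * y) = residue x * residue y"
proof -
  have "x * y = (\<Sum>b\<in>UNIV. of_int (Poly_Mapping.lookup y (Mul b)) * (x * teich b))"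
    by (subst monoid_ring_expansion[of y]) (simp add: sum_distrib_left mult_ac)
  then show ?thesis
    by (simp add: residue_sum residue_of_int_mult residue_mult_teich) (simp add: residue_def sum_distrib_left mult_ac)
qed

lemma residue_1: "residue 1 = 1"
  using residue_teich[of 1] by (simp add: teich_1)

lemma residue_power: "residue (x ^ n) = residue x ^ n"
  by (induction n) (auto simp: residue_1 residue_mult)

lemma additive_of_int_mult:
  fixes g :: "'a::ring_1 \<Rightarrow> 'b::ring_1"
  assumes add: "\<And>x y. g (x + y) = g x + g y"
  shows "g (of_int n * x) = of_int n * g x"
proof -
  have g0: "g 0 = 0" using add[of 0 0] by simp
  have gm: "g (- x) = - g x" for x using add[of x "- x"] g0 by (simp add: eq_neg_iff_add_eq_0 add.commute)
  have nat: "g (of_nat m * x) = of_nat m * g x" for m x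
    by (induction m) (auto simp: g0 add distrib_right)
  show ?thesis
  proof (cases n)
    case (nonneg m)
    then show ?thesis by (simp add: nat)
  next
    case (neg m)
    then show ?thesis using nat[of "Suc m" x] gm by (simp del: of_nat_Suc)
  qed
qed

section \<open>The trace to the prime field and the localising element\<close>

locale finite_field_card =
  fixes ty :: "'a::{field,finite} itself" and p e :: nat
  assumes p_eq: "p = CHAR('a)" and card_eq: "CARD('a) = p ^ e"
begin

lemma prime_p: "prime p"
  using CHAR_finite_field_prime p_eq by simp

lemma e_pos: "e > 0"
  using card_field_gt_1[where 'a = 'a] card_eq by (cases e) auto

definition field_trace :: "'a \<Rightarrow> 'a" where
  "field_trace a = (\<Sum>j<e. a ^ (p ^ j))"

lemma field_trace_add: "field_trace (a + b) = field_trace a + field_trace b"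
proof -
  have "(a + b) ^ (p ^ j) = a ^ (p ^ j) + b ^ (p ^ j)" for j
    using freshmans_dream' CHAR_finite_field_prime p_eq by blast
  then show ?thesis by (simp add: field_trace_def sum.distrib)
qed

lemma field_trace_0: "field_trace 0 = 0"
  using prime_gt_0_nat[OF prime_p] by (simp add: field_trace_def zero_power)

lemma field_trace_sum: "field_trace (\<Sum>i\<in>I. f i) = (\<Sum>i\<in>I. field_trace (f i))"
  by (induction I rule: infinite_finite_induct) (auto simp: field_trace_add field_trace_0)

text \<open>Frobenius permutes the conjugates cyclically, as \<open>a ^ (p ^ e) = a\<close>; the two
  sums are compared after adding the term \<open>a\<close>.\<close>

lemma field_trace_power: "field_trace a ^ p = field_trace a"
proof -
  have "field_trace a ^ p = (\<Sum>j<e. a ^ (p ^ Suc j))"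
    using freshmans_dream_sum[of p "\<lambda>j. a ^ (p ^ j)" "{..<e}"] prime_p
    unfolding p_eq[symmetric] by (simp add: field_trace_def mult.commute flip: power_mult)
  also have "\<dots> + a ^ (p ^ 0) = (\<Sum>j<Suc e. a ^ (p ^ j))"
    by (subst sum.lessThan_Suc_shift) simp
  also have "\<dots> = field_trace a + a"
    using finite_field_power_card[of a] card_eq by (simp add: field_trace_def)
  finally show ?thesis by simp
qed

text \<open>The \<open>p\<close> elements of the prime field are roots of \<open>X ^ p - X\<close>,
  hence all its roots, and the trace is a root as well.\<close>

lemma field_trace_int: "\<exists>t::int. of_int t = field_trace a"
proof -
  let ?P = "monom 1 p - monom 1 1 :: 'a poly"
  have p1: "p > 1" using prime_p prime_gt_1_nat by blast
  have "coeff ?P p = 1" using p1 by simp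
  then have ne: "?P \<noteq> 0" by (metis coeff_0 zero_neq_one)
  have "degree ?P \<le> p"
    by (rule degree_diff_le) (use p1 in \<open>auto simp: degree_monom_eq\<close>)
  then have le: "card {x. poly ?P x = 0} \<le> p" using card_poly_roots_bound[OF ne] by simp
  have pow: "(of_nat m :: 'a) ^ p = of_nat m" for m
    by (induction m) (use freshmans_dream[of p 1 "of_nat _ :: 'a"] prime_p p_eq p1 in auto)
  have "inj_on (of_nat :: nat \<Rightarrow> 'a) {..<p}"
    by (rule inj_onI) (auto simp: of_nat_eq_iff_cong_CHAR cong_def p_eq)
  then have "card (of_nat ` {..<p} :: 'a set) = p" by (simp add: card_image)
  moreover have "of_nat ` {..<p} \<subseteq> {x. poly ?P x = 0}" by (auto simp: poly_monom pow)
  ultimately have "of_nat ` {..<p} = {x. poly ?P x = 0}"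
    using le by (intro card_seteq) simp_all
  moreover have "field_trace a \<in> {x. poly ?P x = 0}"
    using field_trace_power by (simp add: poly_monom)
  ultimately obtain m where "field_trace a = of_nat m" by auto
  then show ?thesis by (intro exI[of _ "int m"]) simp
qed

text \<open>At 0 any multiple of \<open>p\<close> would be a lift; the value 0 makes
  \<open>eps * teich 0\<close> vanish exactly and not only modulo \<open>p\<close>.\<close>

definition itrace :: "'a \<Rightarrow> int" where
  "itrace a = (if a = 0 then 0 else SOME t. of_int t = field_trace a)"

lemma of_int_itrace: "of_int (itrace a) = field_trace a"
  using someI_ex[OF field_trace_int[of a]] by (auto simp: itrace_def field_trace_0)

text \<open>
  Modulo \<open>p\<close>, \<open>- eps\<close> is the sum of the Galois conjugates of the idempotent of \<open>F\<^sub>q[F\<^sub>q]\<close> belonging to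
  the character \<^const>\<open>residue\<close>; subtracting \<open>teich 0\<close> makes it annihilate \<open>teich 0\<close>, which is not zero in the monoid ring.
\<close>

definition eps :: "'a monoid_ring" where
  "eps = (\<Sum>a\<in>UNIV - {0}. of_int (itrace (1 / a)) * (teich a - teich 0))"

text \<open>Substitute \<open>c = a * b\<close>. For \<open>b = 0\<close> both sides vanish: the
  left because \<open>teich 0\<close> is subtracted, the right because
  \<open>itrace 0 = 0\<close>.\<close>

lemma eps_mult_teich:
  "eps * teich b = (\<Sum>c\<in>UNIV - {0}. of_int (itrace (b / c)) * (teich c - teich 0))"
proof -
  have "eps * teich b = (\<Sum>a\<in>UNIV - {0}. of_int (itrace (1 / a)) * (teich (a * b) - teich 0))"
    by (simp add: eps_def sum_distrib_right left_diff_distrib mult.assoc flip: teich_mult)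
  also have "\<dots> = (\<Sum>c\<in>UNIV - {0}. of_int (itrace (b / c)) * (teich c - teich 0))"
  proof (cases "b = 0")
    case True
    then show ?thesis by (simp add: itrace_def)
  next
    case False
    then show ?thesis
      by (intro sum.reindex_bij_witness[of _ "\<lambda>c. c / b" "\<lambda>a. a * b"]) auto
  qed
  finally show ?thesis .
qed

lemma eps_mult_teich_0: "eps * teich 0 = 0"
  by (simp add: eps_mult_teich itrace_def)

text \<open>By linearity of the trace, the coefficient of \<open>teich c - teich 0\<close> in
  \<open>eps * y\<close> maps in the field to the trace of \<open>residue y / c\<close>, which is
  0.\<close>

lemma CHAR_dvd_eps_mult:
  assumes "residue y = 0"
  shows "of_nat p dvd eps * y"
proof -
  let ?y = "\<lambda>b. Poly_Mapping.lookup y (Mul b)"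
  have "eps * y = (\<Sum>b\<in>UNIV. of_int (?y b) * (eps * teich b))"
    by (subst monoid_ring_expansion[of y]) (simp add: sum_distrib_left mult_ac)
  also have "\<dots> = (\<Sum>c\<in>UNIV - {0}. of_int (\<Sum>b\<in>UNIV. ?y b * itrace (b / c)) * (teich c - teich 0))"
    unfolding eps_mult_teich sum_distrib_left of_int_sum sum_distrib_right
    by (subst sum.swap) (simp add: mult.assoc)
  also have "of_nat p dvd \<dots>"
  proof (intro dvd_sum dvd_mult2)
    fix c :: 'a
    have "of_int (\<Sum>b\<in>UNIV. ?y b * itrace (b / c)) = (\<Sum>b\<in>UNIV. of_int (?y b) * field_trace (b / c))"
      by (simp add: of_int_itrace)
    also have "\<dots> = field_trace (\<Sum>b\<in>UNIV. of_int (?y b) * (b / c))"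
      unfolding field_trace_sum using additive_of_int_mult[of field_trace, OF field_trace_add]
      by (intro sum.cong) (simp_all del: times_divide_eq_right)
    also have "(\<Sum>b\<in>UNIV. of_int (?y b) * (b / c)) = residue y / c"
      by (simp add: residue_def sum_divide_distrib)
    finally have "of_int (\<Sum>b\<in>UNIV. ?y b * itrace (b / c)) = (0::'a)"
      using assms by (simp add: field_trace_0)
    then have "int p dvd (\<Sum>b\<in>UNIV. ?y b * itrace (b / c))"
      by (simp only: of_int_eq_0_iff_char_dvd p_eq[symmetric])
    then obtain t where "(\<Sum>b\<in>UNIV. ?y b * itrace (b / c)) = int p * t" by (rule dvdE)
    then show "(of_nat p :: 'a monoid_ring) dvd of_int (\<Sum>b\<in>UNIV. ?y b * itrace (b / c))"
      by (simp only: of_int_mult of_int_of_nat_eq dvd_triv_left)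
  qed
  finally show ?thesis .
qed

text \<open>The \<open>j\<close>-th conjugate contributes the sum of \<open>a ^ (p ^ j - 1)\<close>
  over nonzero \<open>a\<close>. For \<open>0 < j < e\<close> it vanishes, the exponent being
  positive and below \<open>q - 1\<close>; for \<open>j = 0\<close> it is \<open>q - 1\<close>, that
  is \<open>- 1\<close> in the field.\<close>

lemma residue_eps: "residue eps = - 1"
proof -
  have "residue eps = (\<Sum>a\<in>UNIV - {0}. \<Sum>j<e. (1 / a) ^ (p ^ j) * a)"
    by (simp add: eps_def residue_sum residue_of_int_mult residue_diff residue_teich of_int_itrace
        field_trace_def sum_distrib_right)
  also have "\<dots> = (\<Sum>j<e. \<Sum>a\<in>UNIV - {0::'a}. (1 / a) ^ (p ^ j) * a)"
    by (rule sum.swap)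
  also have "\<dots> = (\<Sum>j<e. \<Sum>a\<in>UNIV - {0::'a}. a ^ (p ^ j - 1))"
  proof (rule sum.cong)
    fix j
    obtain n where "p ^ j = Suc n" using prime_gt_0_nat[OF prime_p] by (metis gr0_conv_Suc zero_less_power)
    then have "a ^ (p ^ j) * (1 / a) = a ^ (p ^ j - 1)" if "a \<noteq> 0" for a :: 'a
      using that by simp
    from this[of "1 / a" for a]
    have "(1 / a) ^ (p ^ j - 1) = (1 / a) ^ (p ^ j) * a" if "a \<noteq> 0" for a :: 'a
      using that by simp
    then show "(\<Sum>a\<in>UNIV - {0::'a}. (1 / a) ^ (p ^ j) * a) = (\<Sum>a\<in>UNIV - {0::'a}. a ^ (p ^ j - 1))"
      by (intro sum.reindex_bij_witness[of _ "\<lambda>a. 1 / a" "\<lambda>a. 1 / a"]) auto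
  qed simp
  also have "\<dots> = (\<Sum>j<e. if j = 0 then - 1 else 0)"
  proof (rule sum.cong)
    fix j assume j: "j \<in> {..<e}"
    have p1: "p > 1" using prime_p prime_gt_1_nat by blast
    show "(\<Sum>a\<in>UNIV - {0::'a}. a ^ (p ^ j - 1)) = (if j = 0 then - 1 else 0)"
    proof (cases "j = 0")
      case True
      have "of_nat CARD('a) = (0::'a)" using card_eq p_eq e_pos by (simp add: zero_power)
      then show ?thesis using True card_field_gt_1[where 'a = 'a] by (simp add: of_nat_diff)
    next
      case False
      have "1 < p ^ j" using False p1 by (intro one_less_power) auto
      moreover have "p ^ j < p ^ e" using j p1 by simp
      ultimately have "\<not> CARD('a) - 1 dvd p ^ j - 1" unfolding card_eq
        by (intro nat_dvd_not_less) linarith+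
      then show ?thesis using False by (simp add: sum_powers_eq_0)
    qed
  qed simp
  also have "\<dots> = - 1" using e_pos by simp
  finally show ?thesis .
qed

text \<open>
  Elements of \<open>p ^ k R\<close> in the localisation at \<open>eps\<close>. Since \<open>eps\<close> is not nilpotent modulo \<open>p\<close>, an integer
  in this ideal is divisible by \<open>p ^ k\<close>; since \<open>eps\<close> maps the kernel of \<^const>\<open>residue\<close> into \<open>p R\<close>, that
  kernel lies in the first step of the filtration.
\<close>

definition deep :: "nat \<Rightarrow> 'a monoid_ring \<Rightarrow> bool" where
  "deep k y \<longleftrightarrow> (\<exists>m. of_nat (p ^ k) dvd eps ^ m * y)"

lemma deep_0: "deep 0 y"
  by (simp add: deep_def)

lemma deep_mult:
  assumes "deep j x" "deep k y"
  shows "deep (j + k) (x * y)"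
proof -
  obtain m n where "of_nat (p ^ j) dvd eps ^ m * x" "of_nat (p ^ k) dvd eps ^ n * y"
    using assms by (auto simp: deep_def)
  then have "of_nat (p ^ j) * of_nat (p ^ k) dvd (eps ^ m * x) * (eps ^ n * y)" by (rule mult_dvd_mono)
  then show ?thesis unfolding deep_def by (intro exI[of _ "m + n"]) (simp add: power_add mult_ac)
qed

lemma deep_mult_left: "deep k y \<Longrightarrow> deep k (x * y)"
  using deep_mult[OF deep_0, of k y x] by simp

lemma deep_mult_right: "deep k y \<Longrightarrow> deep k (y * x)"
  using deep_mult_left[of k y x] by (simp add: mult.commute)

lemma deep_mono:
  assumes "deep k y" "j \<le> k"
  shows "deep j y"
proof -
  have "(of_nat (p ^ j) :: 'a monoid_ring) dvd of_nat (p ^ k)"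
    using assms(2) by (simp add: le_imp_power_dvd)
  then show ?thesis using assms(1) dvd_trans unfolding deep_def by blast
qed

lemma deep_add:
  assumes "deep k x" "deep k y"
  shows "deep k (x + y)"
proof -
  obtain m n where "of_nat (p ^ k) dvd eps ^ m * x" "of_nat (p ^ k) dvd eps ^ n * y"
    using assms by (auto simp: deep_def)
  then have "of_nat (p ^ k) dvd eps ^ n * (eps ^ m * x) + eps ^ m * (eps ^ n * y)"
    using dvd_add dvd_mult by blast
  then show ?thesis unfolding deep_def by (intro exI[of _ "m + n"]) (simp add: power_add algebra_simps)
qed

lemma deep_minus: "deep k x \<Longrightarrow> deep k (- x)"
  by (simp add: deep_def)

lemma deep_diff: "deep k x \<Longrightarrow> deep k y \<Longrightarrow> deep k (x - y)"
  using deep_add[OF _ deep_minus] by simp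

lemma deep_zero: "deep k 0"
  by (simp add: deep_def)

lemma deep_sum: "(\<And>i. i \<in> I \<Longrightarrow> deep k (f i)) \<Longrightarrow> deep k (\<Sum>i\<in>I. f i)"
  by (induction I rule: infinite_finite_induct) (auto simp: deep_zero deep_add)

lemma deep_of_nat:
  assumes "p ^ k dvd n"
  shows "deep k (of_nat n)"
proof -
  have "(of_nat (p ^ k) :: 'a monoid_ring) dvd of_nat n" using assms by (auto simp: dvd_def)
  then show ?thesis unfolding deep_def by (intro exI[of _ 0]) simp
qed

lemma deep_power: "deep 1 x \<Longrightarrow> deep k (x ^ k)"
  using deep_mult[of 1 x] by (induction k) (auto simp: deep_0)

lemma deep_residue: "residue y = 0 \<Longrightarrow> deep 1 y"
  using CHAR_dvd_eps_mult unfolding deep_def by (intro exI[of _ 1]) simp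

lemma deep_teich_0: "deep k (teich 0)"
  unfolding deep_def using eps_mult_teich_0 by (intro exI[of _ 1]) simp

text \<open>This leads back to congruences of integers. Some coefficient of \<open>eps ^ m\<close>
  is prime to \<open>p\<close>, since otherwise \<open>residue (eps ^ m)\<close>, a power of
  \<open>- 1\<close>, would be 0; that coefficient can be cancelled.\<close>

lemma deep_of_int_dvd:
  assumes "deep k (of_int n)"
  shows "int (p ^ k) dvd n"
proof -
  obtain m where "of_nat (p ^ k) dvd eps ^ m * of_int n" using assms by (auto simp: deep_def)
  then obtain z where "eps ^ m * of_int n = of_nat (p ^ k) * z" by (auto simp: dvd_def)
  then have z: "of_int n * eps ^ m = of_int (int (p ^ k)) * z" by (simp add: mult.commute)
  have "n * Poly_Mapping.lookup (eps ^ m) x = int (p ^ k) * Poly_Mapping.lookup z x" for x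
    using arg_cong[OF z, of "\<lambda>y. Poly_Mapping.lookup y x"] by (simp only: lookup_of_int_mult)
  then have dvd: "int (p ^ k) dvd n * Poly_Mapping.lookup (eps ^ m) x" for x by simp
  have "\<exists>a. \<not> int p dvd Poly_Mapping.lookup (eps ^ m) (Mul a)"
  proof (rule ccontr)
    assume "\<not> ?thesis"
    then have "(of_int (Poly_Mapping.lookup (eps ^ m) (Mul a)) :: 'a) = 0" for a
      using p_eq by (simp add: of_int_eq_0_iff_char_dvd)
    then have "residue (eps ^ m) = 0" by (simp add: residue_def)
    then show False by (simp add: residue_power residue_eps)
  qed
  then obtain a where "\<not> int p dvd Poly_Mapping.lookup (eps ^ m) (Mul a)" by blast
  then have "coprime (int p ^ k) (Poly_Mapping.lookup (eps ^ m) (Mul a))"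
    using prime_p by (simp add: prime_imp_coprime)
  then show ?thesis using dvd[of "Mul a"] by (simp add: coprime_dvd_mult_left_iff)
qed

section \<open>Frobenius powers, indicators and power sums in the filtration\<close>

lemma deep_prod_diff:
  assumes "\<And>i. i \<in> I \<Longrightarrow> deep k (f i - g i)"
  shows "deep k ((\<Prod>i\<in>I. f i) - (\<Prod>i\<in>I. g i))"
  using assms
proof (induction I rule: infinite_finite_induct)
  case (insert i I)
  have "prod f (insert i I) - prod g (insert i I) =
      (f i - g i) * prod f I + g i * (prod f I - prod g I)"
    using insert by (simp add: algebra_simps)
  then show ?case using insert by (simp add: deep_add deep_mult_left deep_mult_right)
qed (auto simp: deep_zero)

lemma deep_power_diff: "deep k (x - y) \<Longrightarrow> deep k (x ^ n - y ^ n)"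
  using deep_prod_diff[of "{..<n}" k "\<lambda>_. x" "\<lambda>_. y"] by simp

text \<open>Expand \<open>(z + y) ^ p\<close> with \<open>z = x - y\<close>: the middle terms gain a
  factor \<open>p\<close> from the binomial coefficient, and \<open>z ^ p\<close> contains
  \<open>z * z\<close>, of depth \<open>2 * (k + 1)\<close>, which is at least
  \<open>k + 2\<close>.\<close>

lemma deep_frobenius_step:
  assumes "deep (Suc k) (x - y)"
  shows "deep (Suc (Suc k)) (x ^ p - y ^ p)"
proof -
  define z where "z = x - y"
  have z: "deep (Suc k) z" using assms z_def by simp
  have p1: "p > 1" using prime_p prime_gt_1_nat by blast
  have "x ^ p = (z + y) ^ p" by (simp add: z_def)
  also have "\<dots> = (\<Sum>i\<le>p. of_nat (p choose i) * z ^ i * y ^ (p - i))" by (rule binomial_ring)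
  also have "\<dots> = y ^ p + (\<Sum>i\<in>{1..p}. of_nat (p choose i) * z ^ i * y ^ (p - i))"
    by (simp add: sum.atLeast_Suc_atMost atMost_atLeast0)
  finally have *: "x ^ p - y ^ p = (\<Sum>i\<in>{1..p}. of_nat (p choose i) * z ^ i * y ^ (p - i))" by simp
  show ?thesis unfolding *
  proof (rule deep_sum, rule deep_mult_right)
    fix i assume i: "i \<in> {1..p}"
    show "deep (Suc (Suc k)) (of_nat (p choose i) * z ^ i)"
    proof (cases "i = p")
      case True
      have "z ^ p = z ^ (p - 2) * (z * z)"
      proof -
        have "p = (p - 2) + 2" using p1 by simp
        then have "z ^ p = z ^ ((p - 2) + 2)" by (rule arg_cong)
        then show ?thesis by (simp only: power_add power2_eq_square)
      qed
      moreover have "deep (Suc k + Suc k) (z * z)" using z by (intro deep_mult)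
      then have "deep (Suc (Suc k)) (z * z)" by (rule deep_mono) simp
      ultimately show ?thesis using True by (simp add: deep_mult_left)
    next
      case False
      then have "p dvd (p choose i)" using i prime_p by (intro dvd_choose_prime) auto
      then have "deep 1 (of_nat (p choose i))" by (intro deep_of_nat) simp
      moreover have "z ^ i = z * z ^ (i - 1)" using i by (cases i) auto
      then have "deep (Suc k) (z ^ i)" using z deep_mult_right by simp
      ultimately have "deep (1 + Suc k) (of_nat (p choose i) * z ^ i)" by (rule deep_mult)
      then show ?thesis by simp
    qed
  qed
qed

lemma deep_frobenius:
  assumes "deep 1 (x - y)"
  shows "deep (Suc k) (x ^ (p ^ k) - y ^ (p ^ k))"
proof (induction k)
  case (Suc k)
  then show ?case using deep_frobenius_step[OF Suc] by (simp add: mult.commute flip: power_mult)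
qed (use assms in simp)

text \<open>As \<open>x\<close> and \<open>teich (residue x)\<close> agree to depth 1, their
  \<open>q\<close>-th powers agree to depth \<open>e\<close>. Raised further to the power
  \<open>q - 1\<close>, the latter becomes \<open>teich 1 = 1\<close> or \<open>teich 0\<close>, and
  \<open>teich 0\<close> has every depth.\<close>

lemma deep_indicator:
  "deep e (1 - x ^ (CARD('a) * (CARD('a) - 1)) - (if residue x = 0 then 1 else 0))"
proof -
  have q: "CARD('a) > 1" by (rule card_field_gt_1)
  have "deep 1 (x - teich (residue x))" by (rule deep_residue) (simp add: residue_diff residue_teich)
  then have "deep (Suc e) (x ^ (p ^ e) - teich (residue x) ^ (p ^ e))" by (rule deep_frobenius)
  then have "deep e (x ^ CARD('a) - teich (residue x) ^ CARD('a))"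
    unfolding card_eq by (rule deep_mono) simp
  then have "deep e ((x ^ CARD('a)) ^ (CARD('a) - 1) - (teich (residue x) ^ CARD('a)) ^ (CARD('a) - 1))"
    by (rule deep_power_diff)
  moreover have "(teich (residue x) ^ CARD('a)) ^ (CARD('a) - 1) = teich (residue x ^ (CARD('a) - 1))"
    by (simp add: finite_field_power_card flip: teich_power)
  ultimately have *: "deep e (x ^ (CARD('a) * (CARD('a) - 1)) - teich (residue x ^ (CARD('a) - 1)))"
    by (simp add: power_mult)
  show ?thesis
  proof (cases "residue x = 0")
    case True
    then have "deep e (x ^ (CARD('a) * (CARD('a) - 1)) - teich 0)" using * q by (simp add: zero_power)
    then have "deep e (x ^ (CARD('a) * (CARD('a) - 1)) - teich 0 + teich 0)" using deep_teich_0 by (rule deep_add)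
    then show ?thesis using True deep_minus by simp
  next
    case False
    then have "deep e (x ^ (CARD('a) * (CARD('a) - 1)) - 1)"
      using * finite_field_power_card_minus_1[OF False] by (simp add: teich_1)
    from deep_minus[OF this] show ?thesis using False by simp
  qed
qed

text \<open>For \<open>k = 0\<close> all \<open>q\<close> summands are 1, also that of
  \<open>a = 0\<close>. Otherwise rescaling by \<open>g\<close> shows that
  \<open>1 - teich h\<close> annihilates the sum for some \<open>h\<close> other than 1. Up to depth
  1 this factor is invertible, and iteration gives depth \<open>e\<close>.\<close>

lemma deep_sum_teich_power:
  assumes "k = 0 \<or> \<not> CARD('a) - 1 dvd k"
  shows "deep e (\<Sum>a\<in>UNIV. teich (a::'a) ^ k)"
proof (cases "k = 0")
  case True
  then show ?thesis using deep_of_nat[of e "CARD('a)"] card_eq by simp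
next
  case False
  with assms obtain g :: 'a where g: "g \<noteq> 0" "g ^ k \<noteq> 1" using exists_power_neq_1 by blast
  define S where "S = (\<Sum>a\<in>UNIV. teich (a::'a) ^ k)"
  define h where "h = g ^ k"
  have "(\<Sum>a\<in>UNIV. teich (g * a) ^ k) = S"
    unfolding S_def
    by (rule sum.reindex_bij_witness[of _ "\<lambda>y. y / g" "\<lambda>y. g * y"]) (use g in auto)
  then have "teich h * S = S"
    by (simp add: h_def S_def teich_mult teich_power power_mult_distrib sum_distrib_left)
  \<comment> \<open>As \<open>teich (1 / (1 - h)) * teich (1 - h) = 1\<close>, this equals
    \<open>1 - teich (1 / (1 - h)) * (1 - teich h)\<close>; it has residue 0 and fixes
    \<open>S\<close>.\<close>
  define u where "u = teich (1 / (1 - h)) * (teich (1 - h) - (1 - teich h))"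
  have "residue u = 0"
    by (simp add: u_def residue_mult residue_diff residue_teich residue_1)
  then have u: "deep 1 u" by (rule deep_residue)
  have "u * S = teich (1 / (1 - h)) * teich (1 - h) * S - teich (1 / (1 - h)) * (S - teich h * S)"
    by (simp add: u_def algebra_simps)
  also have "\<dots> = S"
    using g \<open>teich h * S = S\<close> by (simp add: h_def teich_1 flip: teich_mult)
  finally have "u * S = S" .
  then have "u ^ n * S = S" for n by (induction n) (auto simp: mult.assoc)
  then show ?thesis using deep_mult_right[OF deep_power[OF u], of e S] unfolding S_def by simp
qed

end

subsection \<open>Counting zeros\<close>

context finite_field_card
begin

text \<open>Total 0 accounts for the constant 1 in \<open>1 - F ^ (q * (q - 1))\<close>, the other
  total for the multinomial expansion of the power.\<close>

definition exponents :: "(nat \<Rightarrow> nat) set \<Rightarrow> ((nat \<Rightarrow> nat) \<Rightarrow> nat) set" where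
  "exponents A = {k \<in> A \<rightarrow>\<^sub>E {..CARD('a) * (CARD('a) - 1)}. sum k A \<in> {0, CARD('a) * (CARD('a) - 1)}}"

lemma finite_exponents: "finite A \<Longrightarrow> finite (exponents A)"
  unfolding exponents_def
  by (rule finite_subset[of _ "A \<rightarrow>\<^sub>E {..CARD('a) * (CARD('a) - 1)}"]) (auto intro!: finite_PiE)

definition sgn_exponent :: "(nat \<Rightarrow> nat) set \<Rightarrow> ((nat \<Rightarrow> nat) \<Rightarrow> nat) \<Rightarrow> 'a monoid_ring" where
  "sgn_exponent A k = (if sum k A = 0 then 1 else - 1)"

lemma one_minus_power_expansion:
  fixes z :: "(nat \<Rightarrow> nat) \<Rightarrow> 'a monoid_ring"
  assumes "finite A"
  shows "1 - (\<Sum>a\<in>A. z a) ^ (CARD('a) * (CARD('a) - 1)) =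
    (\<Sum>k\<in>exponents A. sgn_exponent A k * of_nat (multinomial A k) * (\<Prod>a\<in>A. z a ^ k a))"
proof -
  let ?M = "CARD('a) * (CARD('a) - 1)"
  let ?t = "\<lambda>k. sgn_exponent A k * of_nat (multinomial A k) * (\<Prod>a\<in>A. z a ^ k a)"
  have M: "?M > 0" using card_field_gt_1[where 'a = 'a] by simp
  let ?K = "\<lambda>m. {k \<in> A \<rightarrow>\<^sub>E {..?M}. sum k A = m}"
  have fin: "finite (?K m)" for m
    by (rule finite_subset[of _ "A \<rightarrow>\<^sub>E {..?M}"]) (use assms in \<open>auto intro!: finite_PiE\<close>)
  have "?K 0 = {\<lambda>a. if a \<in> A then 0 else undefined}"
    using assms by (auto simp: PiE_def extensional_def fun_eq_iff)
  then have "sum ?t (?K 0) = ?t (\<lambda>a. if a \<in> A then 0 else undefined)" by simp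
  also have "\<dots> = 1" using assms by (simp add: sgn_exponent_def multinomial_def)
  finally have 0: "sum ?t (?K 0) = 1" .
  have "sum ?t (?K ?M) = - (\<Sum>k | k \<in> A \<rightarrow>\<^sub>E {..?M} \<and> sum k A = ?M. of_nat (multinomial A k) * (\<Prod>a\<in>A. z a ^ k a))"
    using M by (simp add: sgn_exponent_def sum_negf)
  also have "\<dots> = - ((\<Sum>a\<in>A. z a) ^ ?M)" by (simp add: multinomial_theorem[OF assms])
  finally have 1: "sum ?t (?K ?M) = - ((\<Sum>a\<in>A. z a) ^ ?M)" .
  have "exponents A = ?K 0 \<union> ?K ?M" by (auto simp: exponents_def)
  moreover have "?K 0 \<inter> ?K ?M = {}" using M by auto
  ultimately have "sum ?t (exponents A) = sum ?t (?K 0) + sum ?t (?K ?M)"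
    using fin by (simp add: sum.union_disjoint)
  then show ?thesis using 0 1 by simp
qed

text \<open>The contribution of one choice \<open>k\<close> of multinomial exponents, already summed over all points.\<close>

definition point_term ::
  "nat \<Rightarrow> nat set \<Rightarrow> (nat \<Rightarrow> (nat \<Rightarrow> nat) set) \<Rightarrow> (nat \<Rightarrow> (nat \<Rightarrow> nat) \<Rightarrow> 'a) \<Rightarrow>
    (nat \<Rightarrow> (nat \<Rightarrow> nat) \<Rightarrow> nat) \<Rightarrow> 'a monoid_ring" where
  "point_term n I A c k =
    (\<Prod>l\<in>I. sgn_exponent (A l) (k l)) * of_nat (\<Prod>l\<in>I. multinomial (A l) (k l)) *
    (\<Prod>l\<in>I. \<Prod>a\<in>A l. teich (c l a) ^ k l a) *
    (\<Prod>i<n. \<Sum>y\<in>UNIV. teich (y::'a) ^ (\<Sum>l\<in>I. \<Sum>a\<in>A l. k l a * a i))"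

text \<open>After multiplying out, the exponents of each variable are collected, and the sum over
  all points factors into one power sum per variable.\<close>

lemma sum_indicators_expansion:
  assumes "finite I" "\<And>l. l \<in> I \<Longrightarrow> finite (A l)"
  shows "(\<Sum>x\<in>{..<n} \<rightarrow>\<^sub>E UNIV. \<Prod>l\<in>I.
      1 - (\<Sum>a\<in>A l. teich (c l a * (\<Prod>i<n. x i ^ a i))) ^ (CARD('a) * (CARD('a) - 1)))
    = (\<Sum>k\<in>Pi\<^sub>E I (\<lambda>l. exponents (A l)). point_term n I A c k)"
proof -
  let ?M = "CARD('a) * (CARD('a) - 1)"
  let ?K = "Pi\<^sub>E I (\<lambda>l. exponents (A l))"
  have z: "teich (c l a * (\<Prod>i<n. x i ^ a i)) = teich (c l a) * (\<Prod>i<n. teich (x i) ^ a i)" for l a x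
  proof -
    have "teich (\<Prod>i\<in>S. x i ^ a i) = (\<Prod>i\<in>S. teich (x i) ^ a i)" for S :: "nat set"
      by (induction S rule: infinite_finite_induct) (auto simp: teich_1 teich_mult teich_power)
    then show ?thesis by (simp add: teich_mult)
  qed
  have zk: "(teich (c l a) * (\<Prod>i<n. teich (x i) ^ a i)) ^ m =
      teich (c l a) ^ m * (\<Prod>i<n. teich (x i) ^ (m * a i))" for l a x m
    by (simp add: power_mult_distrib prod_power_distrib mult.commute flip: power_mult)
  have "(\<Prod>l\<in>I. 1 - (\<Sum>a\<in>A l. teich (c l a * (\<Prod>i<n. x i ^ a i))) ^ ?M) =
    (\<Sum>k\<in>?K. (\<Prod>l\<in>I. sgn_exponent (A l) (k l)) * of_nat (\<Prod>l\<in>I. multinomial (A l) (k l)) *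
      (\<Prod>l\<in>I. \<Prod>a\<in>A l. teich (c l a) ^ k l a) *
      (\<Prod>i<n. teich (x i) ^ (\<Sum>l\<in>I. \<Sum>a\<in>A l. k l a * a i)))" for x
  proof -
    have sw: "(\<Prod>l\<in>I. \<Prod>a\<in>A l. \<Prod>i<n. teich (x i) ^ (k l a * a i)) =
      (\<Prod>i<n. teich (x i) ^ (\<Sum>l\<in>I. \<Sum>a\<in>A l. k l a * a i))" for k :: "nat \<Rightarrow> (nat \<Rightarrow> nat) \<Rightarrow> nat"
    proof -
      have "(\<Prod>l\<in>I. \<Prod>a\<in>A l. \<Prod>i<n. teich (x i) ^ (k l a * a i)) =
        (\<Prod>l\<in>I. \<Prod>i<n. \<Prod>a\<in>A l. teich (x i) ^ (k l a * a i))"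
        by (intro prod.cong refl prod.swap)
      also have "\<dots> = (\<Prod>i<n. \<Prod>l\<in>I. \<Prod>a\<in>A l. teich (x i) ^ (k l a * a i))"
        by (rule prod.swap)
      finally show ?thesis by (simp add: power_sum)
    qed
    have "(\<Prod>l\<in>I. 1 - (\<Sum>a\<in>A l. teich (c l a * (\<Prod>i<n. x i ^ a i))) ^ ?M) =
      (\<Prod>l\<in>I. \<Sum>k\<in>exponents (A l). sgn_exponent (A l) k * of_nat (multinomial (A l) k) *
        (\<Prod>a\<in>A l. teich (c l a * (\<Prod>i<n. x i ^ a i)) ^ k a))"
      using assms by (intro prod.cong one_minus_power_expansion) auto
    also have "\<dots> = (\<Sum>k\<in>?K. \<Prod>l\<in>I. sgn_exponent (A l) (k l) * of_nat (multinomial (A l) (k l)) *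
        (\<Prod>a\<in>A l. teich (c l a * (\<Prod>i<n. x i ^ a i)) ^ k l a))"
      using assms finite_exponents by (intro prod_sum_PiE) auto
    also have "\<dots> = (\<Sum>k\<in>?K. (\<Prod>l\<in>I. sgn_exponent (A l) (k l)) * of_nat (\<Prod>l\<in>I. multinomial (A l) (k l)) *
      (\<Prod>l\<in>I. \<Prod>a\<in>A l. teich (c l a) ^ k l a) *
      (\<Prod>l\<in>I. \<Prod>a\<in>A l. \<Prod>i<n. teich (x i) ^ (k l a * a i)))"
      by (simp only: z zk prod.distrib of_nat_prod mult.assoc)
    finally show ?thesis by (simp only: sw)
  qed
  then have "(\<Sum>x\<in>{..<n} \<rightarrow>\<^sub>E UNIV. \<Prod>l\<in>I. 1 - (\<Sum>a\<in>A l. teich (c l a * (\<Prod>i<n. x i ^ a i))) ^ ?M) =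
    (\<Sum>k\<in>?K. (\<Prod>l\<in>I. sgn_exponent (A l) (k l)) * of_nat (\<Prod>l\<in>I. multinomial (A l) (k l)) *
      (\<Prod>l\<in>I. \<Prod>a\<in>A l. teich (c l a) ^ k l a) *
      (\<Sum>x\<in>{..<n} \<rightarrow>\<^sub>E UNIV. \<Prod>i<n. teich (x i) ^ (\<Sum>l\<in>I. \<Sum>a\<in>A l. k l a * a i)))"
    by (simp only: sum_distrib_left) (rule sum.swap)
  moreover have "(\<Sum>x\<in>{..<n} \<rightarrow>\<^sub>E UNIV. \<Prod>i<n. teich (x i) ^ (\<Sum>l\<in>I. \<Sum>a\<in>A l. k l a * a i)) =
    (\<Prod>i<n. \<Sum>y\<in>UNIV. teich (y::'a) ^ (\<Sum>l\<in>I. \<Sum>a\<in>A l. k l a * a i))" for k :: "nat \<Rightarrow> (nat \<Rightarrow> nat) \<Rightarrow> nat"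
    by (rule prod_sum_PiE[symmetric]) auto
  ultimately show ?thesis by (simp only: point_term_def)
qed

text \<open>Three cases. If some variable has exponent 0 or one not divisible by
  \<open>q - 1\<close>, its power sum is deep. If a monomial below top degree occurs, the
  multinomial coefficients are divisible by \<open>p ^ e\<close>. Otherwise only top-degree
  coefficients occur, and both terms are equal.\<close>

lemma deep_point_term_diff:
  fixes A :: "nat \<Rightarrow> (nat \<Rightarrow> nat) set" and c c' :: "nat \<Rightarrow> (nat \<Rightarrow> nat) \<Rightarrow> 'a"
  assumes fin: "finite I" "\<And>l. l \<in> I \<Longrightarrow> finite (A l)"
    and n: "(\<Sum>l\<in>I. D l) \<le> n"
    and deg: "\<And>l a. l \<in> I \<Longrightarrow> a \<in> A l \<Longrightarrow> (\<Sum>i<n. a i) \<le> D l"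
    and top: "\<And>l a. l \<in> I \<Longrightarrow> a \<in> A l \<Longrightarrow> (\<Sum>i<n. a i) = D l \<Longrightarrow> c l a = c' l a"
    and k: "k \<in> Pi\<^sub>E I (\<lambda>l. exponents (A l))"
  shows "deep e (point_term n I A c k - point_term n I A c' k)"
proof -
  let ?b = "\<lambda>i. \<Sum>l\<in>I. \<Sum>a\<in>A l. k l a * a i"
  consider (exp) i where "i < n" "?b i = 0 \<or> \<not> CARD('a) - 1 dvd ?b i"
    | (low) l a where "\<And>i. i < n \<Longrightarrow> 0 < ?b i" "\<And>i. i < n \<Longrightarrow> CARD('a) - 1 dvd ?b i"
        "l \<in> I" "a \<in> A l" "k l a > 0" "(\<Sum>i<n. a i) < D l"
    | (top) "\<And>l a. l \<in> I \<Longrightarrow> a \<in> A l \<Longrightarrow> k l a > 0 \<Longrightarrow> (\<Sum>i<n. a i) \<ge> D l"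
  proof (cases "\<exists>i<n. ?b i = 0 \<or> \<not> CARD('a) - 1 dvd ?b i")
    case True
    then show ?thesis using exp by blast
  next
    case False
    then have 1: "0 < ?b i" "CARD('a) - 1 dvd ?b i" if "i < n" for i using that by auto
    show ?thesis
    proof (cases "\<exists>l\<in>I. \<exists>a\<in>A l. k l a > 0 \<and> (\<Sum>i<n. a i) < D l")
      case True
      then obtain l a where la: "l \<in> I" "a \<in> A l" "k l a > 0" "(\<Sum>i<n. a i) < D l" by blast
      show ?thesis by (rule low[OF 1 la])
    next
      case False
      then have "D l \<le> (\<Sum>i<n. a i)" if "l \<in> I" "a \<in> A l" "k l a > 0" for l a
        using that linorder_not_le by blast
      then show ?thesis by (rule top)
    qed
  qed
  then show ?thesis
  proof cases
    case exp
    have "(\<Prod>i<n. \<Sum>y\<in>UNIV. teich (y::'a) ^ ?b i) =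
        (\<Sum>y\<in>UNIV. teich (y::'a) ^ ?b i) * (\<Prod>i\<in>{..<n} - {i}. \<Sum>y\<in>UNIV. teich (y::'a) ^ ?b i)"
      using exp(1) by (intro prod.remove) auto
    then have "deep e (\<Prod>i<n. \<Sum>y\<in>UNIV. teich (y::'a) ^ ?b i)"
      using deep_mult_right[OF deep_sum_teich_power[OF exp(2)]] by simp
    then show ?thesis unfolding point_term_def by (intro deep_diff deep_mult_left)
  next
    case low
    have "sum (k l) (A l) \<in> {0, CARD('a) * (CARD('a) - 1)}" if "l \<in> I" for l
      using PiE_mem[OF k that] by (simp add: exponents_def)
    then have "p ^ e dvd (\<Prod>l\<in>I. multinomial (A l) (k l))"
      using prime_power_dvd_prod_multinomial[OF prime_p e_pos card_eq fin n _ deg low(3-6) low(1,2)] by blast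
    then have "deep e (of_nat (\<Prod>l\<in>I. multinomial (A l) (k l)))" by (rule deep_of_nat)
    then show ?thesis unfolding point_term_def
      by (intro deep_diff) (intro deep_mult_right deep_mult_left; assumption)+
  next
    case top
    have "teich (c l a) ^ k l a = teich (c' l a) ^ k l a" if "l \<in> I" "a \<in> A l" for l a
      using top[OF that] deg[OF that] assms(5)[OF that] by (cases "k l a = 0") auto
    then have "(\<Prod>l\<in>I. \<Prod>a\<in>A l. teich (c l a) ^ k l a) = (\<Prod>l\<in>I. \<Prod>a\<in>A l. teich (c' l a) ^ k l a)"
      by (intro prod.cong) auto
    then have "point_term n I A c k = point_term n I A c' k" by (simp only: point_term_def)
    then show ?thesis by (simp add: deep_zero)
  qed
qed

text \<open>By \<open>deep_indicator\<close>, the product of the factors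
  \<open>1 - F ^ (q * (q - 1))\<close> is to depth \<open>e\<close> the indicator of a common
  zero.\<close>

lemma deep_card_zeros:
  fixes A :: "nat \<Rightarrow> (nat \<Rightarrow> nat) set" and c :: "nat \<Rightarrow> (nat \<Rightarrow> nat) \<Rightarrow> 'a"
  assumes "finite I" "\<And>l. l \<in> I \<Longrightarrow> finite (A l)"
  shows "deep e ((\<Sum>k\<in>Pi\<^sub>E I (\<lambda>l. exponents (A l)). point_term n I A c k) -
    of_int (int (card {x \<in> {..<n} \<rightarrow>\<^sub>E UNIV. \<forall>l\<in>I. (\<Sum>a\<in>A l. c l a * (\<Prod>i<n. x i ^ a i)) = 0})))"
proof -
  let ?F = "\<lambda>x l. \<Sum>a\<in>A l. teich (c l a * (\<Prod>i<n. x i ^ a i))"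
  let ?f = "\<lambda>x l. \<Sum>a\<in>A l. c l a * (\<Prod>i<n. x i ^ a i)"
  let ?X = "{..<n} \<rightarrow>\<^sub>E (UNIV :: 'a set)"
  have res: "residue (?F x l) = ?f x l" for x l
    by (simp add: residue_sum residue_teich)
  have finX: "finite ?X" by (intro finite_PiE) auto
  have "of_int (int (card {x \<in> ?X. \<forall>l\<in>I. ?f x l = 0})) =
      (\<Sum>x\<in>?X. if \<forall>l\<in>I. ?f x l = 0 then 1 else 0 :: 'a monoid_ring)"
    using finX by (simp add: sum.If_cases Int_def)
  also have "\<dots> = (\<Sum>x\<in>?X. \<Prod>l\<in>I. if residue (?F x l) = 0 then 1 else 0)"
  proof (rule sum.cong)
    fix x
    show "(if \<forall>l\<in>I. ?f x l = 0 then 1 else 0 :: 'a monoid_ring) = (\<Prod>l\<in>I. if residue (?F x l) = 0 then 1 else 0)"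
    proof (cases "\<forall>l\<in>I. ?f x l = 0")
      case False
      then have "\<exists>l\<in>I. (if ?f x l = 0 then 1 else 0 :: 'a monoid_ring) = 0" by auto
      then have "(\<Prod>l\<in>I. if ?f x l = 0 then 1 else 0 :: 'a monoid_ring) = 0"
        by (rule prod_zero[OF assms(1)])
      then show ?thesis using False by (simp only: res if_False)
    qed (simp add: res)
  qed simp
  finally have N: "of_int (int (card {x \<in> ?X. \<forall>l\<in>I. ?f x l = 0})) =
      (\<Sum>x\<in>?X. \<Prod>l\<in>I. if residue (?F x l) = 0 then 1 else 0 :: 'a monoid_ring)" .
  have S: "(\<Sum>k\<in>Pi\<^sub>E I (\<lambda>l. exponents (A l)). point_term n I A c k) =
      (\<Sum>x\<in>?X. \<Prod>l\<in>I. 1 - ?F x l ^ (CARD('a) * (CARD('a) - 1)))"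
    by (rule sum_indicators_expansion[symmetric]) (use assms in auto)
  show ?thesis
    unfolding N S sum_subtractf[symmetric]
    by (rule deep_sum) (rule deep_prod_diff, rule deep_indicator)
qed

lemma card_zeros_cong_if_top_eq:
  fixes A :: "nat \<Rightarrow> (nat \<Rightarrow> nat) set" and c c' :: "nat \<Rightarrow> (nat \<Rightarrow> nat) \<Rightarrow> 'a"
  assumes fin: "finite I" "\<And>l. l \<in> I \<Longrightarrow> finite (A l)"
    and n: "(\<Sum>l\<in>I. D l) \<le> n"
    and deg: "\<And>l a. l \<in> I \<Longrightarrow> a \<in> A l \<Longrightarrow> (\<Sum>i<n. a i) \<le> D l"
    and top: "\<And>l a. l \<in> I \<Longrightarrow> a \<in> A l \<Longrightarrow> (\<Sum>i<n. a i) = D l \<Longrightarrow> c l a = c' l a"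
  shows "[card {x \<in> {..<n} \<rightarrow>\<^sub>E UNIV. \<forall>l\<in>I. (\<Sum>a\<in>A l. c l a * (\<Prod>i<n. x i ^ a i)) = 0} =
    card {x \<in> {..<n} \<rightarrow>\<^sub>E UNIV. \<forall>l\<in>I. (\<Sum>a\<in>A l. c' l a * (\<Prod>i<n. x i ^ a i)) = 0}] (mod CARD('a))"
    (is "[?N c = ?N c'] (mod _)")
proof -
  let ?S = "\<lambda>c. \<Sum>k\<in>Pi\<^sub>E I (\<lambda>l. exponents (A l)). point_term n I A c k"
  have S: "deep e (?S c - of_int (int (?N c)))" for c
    by (rule deep_card_zeros[OF fin])
  have "deep e (?S c - ?S c')"
    unfolding sum_subtractf[symmetric]
    by (rule deep_sum) (rule deep_point_term_diff[OF fin n deg top])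
  \<comment> \<open>The expansion sums cancel, leaving the difference of the two counts.\<close>
  then have "deep e ((?S c - ?S c') - (?S c - of_int (int (?N c))) + (?S c' - of_int (int (?N c'))))"
    by (intro deep_add[OF deep_diff[OF _ S] S])
  then have "deep e (of_int (int (?N c) - int (?N c')))" by (simp add: algebra_simps)
  then have "int (p ^ e) dvd int (?N c) - int (?N c')" by (rule deep_of_int_dvd)
  then show ?thesis unfolding card_eq by (simp only: cong_iff_dvd_diff flip: cong_int_iff)
qed

end

subsection \<open>Reduction to coordinates\<close>

text \<open>
  The polynomial functions in \<open>n\<close> variables of degree strictly less than \<open>D\<close>; the strict bound lets
  \<open>D = 0\<close> denote the zero function.
\<close>

inductive_set poly_funs :: "nat \<Rightarrow> nat \<Rightarrow> ((nat \<Rightarrow> 'a::comm_ring_1) \<Rightarrow> 'a) set" for n D where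
  zero: "(\<lambda>_. 0) \<in> poly_funs n D"
| add: "\<phi> \<in> poly_funs n D \<Longrightarrow> (\<Sum>i<n. a i) < D \<Longrightarrow> (\<lambda>x. \<phi> x + c * (\<Prod>i<n. x i ^ a i)) \<in> poly_funs n D"

lemma poly_funs_monomial:
  "(\<Sum>i<n. a i) < D \<Longrightarrow> (\<lambda>x. c * (\<Prod>i<n. x i ^ a i)) \<in> poly_funs n D"
  using poly_funs.add[OF poly_funs.zero] by simp

lemma poly_funs_plus:
  assumes "\<phi> \<in> poly_funs n D" "\<psi> \<in> poly_funs n D"
  shows "(\<lambda>x. \<phi> x + \<psi> x) \<in> poly_funs n D"
  using assms(2,1)
proof (induction rule: poly_funs.induct)
  case (add \<psi> a c)
  then show ?case using poly_funs.add[of "\<lambda>x. \<phi> x + \<psi> x"] by (simp add: add.assoc)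
qed simp

lemma poly_funs_mono:
  assumes "\<phi> \<in> poly_funs n D" "D \<le> E"
  shows "\<phi> \<in> poly_funs n E"
  using assms by (induction rule: poly_funs.induct) (auto intro: poly_funs.intros)

text \<open>The bounds are asymmetric because \<open>poly_funs\<close> uses strict ones: degree at
  most \<open>D\<close> times degree below \<open>E\<close> stays below
  \<open>D + E\<close>.\<close>

lemma poly_funs_mult:
  assumes "\<phi> \<in> poly_funs n (Suc D)" "\<psi> \<in> poly_funs n E"
  shows "(\<lambda>x. \<phi> x * \<psi> x) \<in> poly_funs n (D + E)"
  using assms(1)
proof (induction rule: poly_funs.induct)
  case zero
  show ?case by (simp add: poly_funs.zero)
next
  case (add \<phi> a c)
  have "(\<lambda>x. c * (\<Prod>i<n. x i ^ a i) * \<psi> x) \<in> poly_funs n (D + E)"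
    using assms(2)
  proof (induction rule: poly_funs.induct)
    case zero
    show ?case by (simp add: poly_funs.zero)
  next
    case (add \<psi> b d)
    have "(\<Sum>i<n. a i + b i) < D + E"
      using \<open>(\<Sum>i<n. a i) < Suc D\<close> add(2) by (simp add: sum.distrib)
    from poly_funs.add[OF add(3) this, of "c * d"] show ?case
      by (simp add: algebra_simps power_add prod.distrib)
  qed
  then show ?case using poly_funs_plus[OF add(3)] by (simp add: distrib_right)
qed

lemma poly_funs_explicit:
  assumes "\<phi> \<in> poly_funs n D"
  shows "\<exists>A c. finite A \<and> (\<forall>a\<in>A. (\<Sum>i<n. a i) < D) \<and> (\<forall>x. \<phi> x = (\<Sum>a\<in>A. c a * (\<Prod>i<n. x i ^ a i)))"
  using assms
proof (induction rule: poly_funs.induct)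
  case zero
  show ?case by (intro exI[of _ "{}"]) simp
next
  case (add \<phi> b d)
  then obtain A c where A: "finite A" "\<forall>a\<in>A. (\<Sum>i<n. a i) < D"
    "\<forall>x. \<phi> x = (\<Sum>a\<in>A. c a * (\<Prod>i<n. x i ^ a i))" by blast
  \<comment> \<open>The exponent \<open>b\<close> may already lie in \<open>A\<close>; then its
    coefficients add up.\<close>
  let ?c = "\<lambda>a. (if a \<in> A then c a else 0) + (if a = b then d else 0)"
  have "(\<Sum>a\<in>insert b A. ?c a * (\<Prod>i<n. x i ^ a i)) = \<phi> x + d * (\<Prod>i<n. x i ^ b i)" for x
  proof -
    have "(\<Sum>a\<in>insert b A. ?c a * (\<Prod>i<n. x i ^ a i)) =
      (\<Sum>a\<in>insert b A. if a \<in> A then c a * (\<Prod>i<n. x i ^ a i) else 0) +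
      (\<Sum>a\<in>insert b A. if a = b then d * (\<Prod>i<n. x i ^ a i) else 0)"
      unfolding sum.distrib[symmetric] by (intro sum.cong) (auto simp: distrib_right)
    moreover have "(\<Sum>a\<in>insert b A. if a \<in> A then c a * (\<Prod>i<n. x i ^ a i) else 0) = \<phi> x"
      unfolding A(3)[rule_format] by (intro sum.mono_neutral_cong_right) (use A in auto)
    ultimately show ?thesis using A(1) by simp
  qed
  then show ?case
    using A add(2) by (intro exI[of _ "insert b A"] exI[of _ ?c]) auto
qed

text \<open>Over a finite field a function does not determine its coefficients, so equality of the
  parts of degree \<open>D\<close> is expressed by the difference having a representation of lower
  degree.\<close>

definition same_top :: "nat \<Rightarrow> nat \<Rightarrow> ((nat \<Rightarrow> 'a::comm_ring_1) \<Rightarrow> 'a) \<Rightarrow> ((nat \<Rightarrow> 'a) \<Rightarrow> 'a) \<Rightarrow> bool" where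
  "same_top n D \<phi> \<psi> \<longleftrightarrow> \<phi> \<in> poly_funs n (Suc D) \<and> \<psi> \<in> poly_funs n (Suc D) \<and>
    (\<lambda>x. \<phi> x - \<psi> x) \<in> poly_funs n D"

lemma same_top_const: "same_top n 0 (\<lambda>_. c) (\<lambda>_. c)"
  using poly_funs_monomial[of "\<lambda>_. 0" n 1 c] by (simp add: same_top_def poly_funs.zero)

lemma same_top_mono: "same_top n D \<phi> \<psi> \<Longrightarrow> D \<le> E \<Longrightarrow> same_top n E \<phi> \<psi>"
  unfolding same_top_def by (auto intro: poly_funs_mono)

lemma same_top_add:
  assumes "same_top n D \<phi> \<psi>" "same_top n D \<phi>' \<psi>'"
  shows "same_top n D (\<lambda>x. \<phi> x + \<phi>' x) (\<lambda>x. \<psi> x + \<psi>' x)"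
proof -
  have "(\<lambda>x. \<phi> x + \<phi>' x - (\<psi> x + \<psi>' x)) = (\<lambda>x. (\<phi> x - \<psi> x) + (\<phi>' x - \<psi>' x))"
    by (simp add: algebra_simps)
  then show ?thesis using assms unfolding same_top_def by (auto intro: poly_funs_plus)
qed

lemma same_top_mult:
  assumes "same_top n D \<phi> \<psi>" "same_top n E \<phi>' \<psi>'"
  shows "same_top n (D + E) (\<lambda>x. \<phi> x * \<phi>' x) (\<lambda>x. \<psi> x * \<psi>' x)"
proof -
  note a = assms[unfolded same_top_def]
  have "(\<lambda>x. \<phi> x * \<phi>' x - \<psi> x * \<psi>' x) = (\<lambda>x. \<phi> x * (\<phi>' x - \<psi>' x) + \<psi>' x * (\<phi> x - \<psi> x))"
    by (simp add: algebra_simps)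
  moreover have "(\<lambda>x. \<phi> x * (\<phi>' x - \<psi>' x)) \<in> poly_funs n (D + E)"
    using a poly_funs_mult[of \<phi> n D "\<lambda>x. \<phi>' x - \<psi>' x" E] by simp
  moreover have "(\<lambda>x. \<psi>' x * (\<phi> x - \<psi> x)) \<in> poly_funs n (E + D)"
    using a poly_funs_mult[of \<psi>' n E "\<lambda>x. \<phi> x - \<psi> x" D] by simp
  ultimately have "(\<lambda>x. \<phi> x * \<phi>' x - \<psi> x * \<psi>' x) \<in> poly_funs n (D + E)"
    using poly_funs_plus by (simp add: add.commute)
  then show ?thesis
    using a poly_funs_mult[of \<phi> n D \<phi>' "Suc E"] poly_funs_mult[of \<psi> n D \<psi>' "Suc E"]
    unfolding same_top_def by simp
qed

lemma same_top_sum: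
  assumes "\<And>i. i \<in> S \<Longrightarrow> same_top n D (\<phi> i) (\<psi> i)"
  shows "same_top n D (\<lambda>x. \<Sum>i\<in>S. \<phi> i x) (\<lambda>x. \<Sum>i\<in>S. \<psi> i x)"
  using assms
proof (induction S rule: infinite_finite_induct)
  case (insert i S)
  then show ?case
    using same_top_add[of n D "\<phi> i" "\<psi> i" "\<lambda>x. \<Sum>i\<in>S. \<phi> i x" "\<lambda>x. \<Sum>i\<in>S. \<psi> i x"] by simp
qed (use same_top_mono[OF same_top_const[of n 0]] in simp_all)

lemma same_top_prod:
  assumes "\<And>i. i \<in> S \<Longrightarrow> same_top n (D i) (\<phi> i) (\<psi> i)"
  shows "same_top n (\<Sum>i\<in>S. D i) (\<lambda>x. \<Prod>i\<in>S. \<phi> i x) (\<lambda>x. \<Prod>i\<in>S. \<psi> i x)"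
  using assms
proof (induction S rule: infinite_finite_induct)
  case (insert i S)
  then show ?case
    using same_top_mult[of n "D i" "\<phi> i" "\<psi> i" "sum D S" "\<lambda>x. \<Prod>i\<in>S. \<phi> i x" "\<lambda>x. \<Prod>i\<in>S. \<psi> i x"] by simp
qed (use same_top_const[of n 1] in simp_all)

lemma same_top_power:
  "same_top n 1 \<phi> \<psi> \<Longrightarrow> same_top n k (\<lambda>x. \<phi> x ^ k) (\<lambda>x. \<psi> x ^ k)"
  using same_top_prod[of "{..<k}" n "\<lambda>_. 1" "\<lambda>_. \<phi>" "\<lambda>_. \<psi>"] by simp

text \<open>A translation of the argument changes an affine form only in its constant term, which
  has degree below 1.\<close>

lemma same_top_affine:
  "same_top n 1 (\<lambda>x. u + (\<Sum>j<n. x j * m j)) (\<lambda>x. v + (\<Sum>j<n. x j * m j))"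
proof -
  have c: "(\<lambda>_. u) \<in> poly_funs n (Suc E)" for u :: 'a and E
    using poly_funs_monomial[of "\<lambda>_. 0" n "Suc E" u] by simp
  have x: "(\<lambda>x. m j * x j) \<in> poly_funs n 2" if "j < n" for j
  proof -
    have "(\<Prod>i<n. x i ^ (if i = j then 1 else 0)) = x j" for x :: "nat \<Rightarrow> 'a"
      using that by (simp add: if_distrib prod.delta cong: if_cong)
    then show ?thesis
      using poly_funs_monomial[of "\<lambda>i. if i = j then 1 else 0" n 2 "m j"] that by simp
  qed
  have "(\<lambda>x. \<Sum>j\<in>S. m j * x j) \<in> poly_funs n 2" if "S \<subseteq> {..<n}" for S
    using finite_subset[OF that] that
    by (induction S rule: finite_induct) (auto intro: poly_funs_plus x poly_funs.zero)
  then have "(\<lambda>x. \<Sum>j<n. x j * m j) \<in> poly_funs n 2" by (simp add: mult.commute)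
  then show ?thesis
    using c[of _ 1] c[of "u - v" 0] by (auto simp: same_top_def numeral_2_eq_2 intro!: poly_funs_plus)
qed

text \<open>The first function is represented as the second plus the lower-degree difference, so the
  coefficients agree in degree \<open>D\<close> by construction.\<close>

lemma same_top_explicit:
  assumes "same_top n D \<phi> \<psi>"
  shows "\<exists>A c c'. finite A \<and> (\<forall>a\<in>A. (\<Sum>i<n. a i) \<le> D) \<and> (\<forall>a\<in>A. (\<Sum>i<n. a i) = D \<longrightarrow> c a = c' a) \<and>
    (\<forall>x. \<phi> x = (\<Sum>a\<in>A. c a * (\<Prod>i<n. x i ^ a i))) \<and> (\<forall>x. \<psi> x = (\<Sum>a\<in>A. c' a * (\<Prod>i<n. x i ^ a i)))"
proof -
  obtain A1 c1 where 1: "finite A1" "\<forall>a\<in>A1. (\<Sum>i<n. a i) < Suc D"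
    "\<forall>x. \<psi> x = (\<Sum>a\<in>A1. c1 a * (\<Prod>i<n. x i ^ a i))"
    using poly_funs_explicit[of \<psi> n "Suc D"] assms unfolding same_top_def by blast
  obtain A2 c2 where 2: "finite A2" "\<forall>a\<in>A2. (\<Sum>i<n. a i) < D"
    "\<forall>x. \<phi> x - \<psi> x = (\<Sum>a\<in>A2. c2 a * (\<Prod>i<n. x i ^ a i))"
    using poly_funs_explicit[of "\<lambda>x. \<phi> x - \<psi> x" n D] assms unfolding same_top_def by blast
  let ?A = "A1 \<union> A2"
  let ?d = "\<lambda>A c a. if a \<in> A then c a else 0"
  have ext: "(\<Sum>a\<in>?A. ?d A c a * (\<Prod>i<n. x i ^ a i)) = (\<Sum>a\<in>A. c a * (\<Prod>i<n. x i ^ a i))"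
    if "A \<subseteq> ?A" for A and c :: "(nat \<Rightarrow> nat) \<Rightarrow> 'a" and x
    using that 1(1) 2(1) by (intro sum.mono_neutral_cong_right) auto
  show ?thesis
  proof (intro exI conjI)
    show "finite ?A" using 1 2 by simp
    show "\<forall>a\<in>?A. (\<Sum>i<n. a i) \<le> D" using 1(2) 2(2) by force
    show "\<forall>a\<in>?A. (\<Sum>i<n. a i) = D \<longrightarrow> ?d A1 c1 a + ?d A2 c2 a = ?d A1 c1 a"
      using 2(2) by force
    show \<psi>: "\<forall>x. \<psi> x = (\<Sum>a\<in>?A. ?d A1 c1 a * (\<Prod>i<n. x i ^ a i))"
      using 1(3) ext[of A1 c1] by simp
    show "\<forall>x. \<phi> x = (\<Sum>a\<in>?A. (?d A1 c1 a + ?d A2 c2 a) * (\<Prod>i<n. x i ^ a i))"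
    proof
      fix x
      have "\<phi> x = \<psi> x + (\<phi> x - \<psi> x)" by simp
      then show "\<phi> x = (\<Sum>a\<in>?A. (?d A1 c1 a + ?d A2 c2 a) * (\<Prod>i<n. x i ^ a i))"
        using 2(3) ext[of A2 c2 x] \<psi> by (simp only: distrib_right sum.distrib) simp
    qed
  qed
qed

text \<open>Coordinates of the two arguments are affine forms with the same linear part, and
  \<open>same_top\<close> passes through powers, products and sums.\<close>

lemma same_top_mpoly_eval:
  fixes f :: "('n::finite, 'a::{field,finite}) mpoly" and g :: "nat \<Rightarrow> 'a ^ 'n"
  shows "same_top n (total_degree f) (\<lambda>x. mpoly_eval f (u + (\<Sum>j<n. x j *s g j)))
    (\<lambda>x. mpoly_eval f (v + (\<Sum>j<n. x j *s g j)))"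
  unfolding mpoly_eval_def
proof (rule same_top_sum)
  fix m assume m: "m \<in> Poly_Mapping.keys f"
  have "(\<Sum>i\<in>UNIV. Poly_Mapping.lookup m i) \<le> total_degree f"
    unfolding total_degree_def using m by (intro Max_ge) auto
  moreover have "same_top n (0 + (\<Sum>i\<in>UNIV. Poly_Mapping.lookup m i))
    (\<lambda>x. Poly_Mapping.lookup f m * (\<Prod>i\<in>UNIV. (u + (\<Sum>j<n. x j *s g j)) $ i ^ Poly_Mapping.lookup m i))
    (\<lambda>x. Poly_Mapping.lookup f m * (\<Prod>i\<in>UNIV. (v + (\<Sum>j<n. x j *s g j)) $ i ^ Poly_Mapping.lookup m i))"
    by (intro same_top_mult same_top_const same_top_prod same_top_power)
      (use same_top_affine[of n "u $ i" "\<lambda>j. g j $ i" "v $ i" for i] in simp)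
  ultimately show "same_top n (total_degree f)
    (\<lambda>x. Poly_Mapping.lookup f m * (\<Prod>i\<in>UNIV. (u + (\<Sum>j<n. x j *s g j)) $ i ^ Poly_Mapping.lookup m i))
    (\<lambda>x. Poly_Mapping.lookup f m * (\<Prod>i\<in>UNIV. (v + (\<Sum>j<n. x j *s g j)) $ i ^ Poly_Mapping.lookup m i))"
    using same_top_mono by simp
qed

text \<open>Coordinates with respect to an enumerated basis; they are extensional functions on the
  indices, as in the counting congruence.\<close>

lemma subspace_parametrization:
  fixes V :: "('a::{field,finite} ^ 'n::finite) set"
  assumes V: "vec.subspace V"
  shows "\<exists>g. bij_betw (\<lambda>x. \<Sum>j<vec.dim V. x j *s g j) ({..<vec.dim V} \<rightarrow>\<^sub>E UNIV) V"
proof -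
  let ?n = "vec.dim V"
  obtain B where B: "B \<subseteq> V" "vec.independent B" "V \<subseteq> vec.span B" "card B = ?n"
    using vec.basis_exists[of V] by blast
  have fin: "finite B" by simp
  have span: "vec.span B = V" using B(1,3) V by (rule vec.span_subspace)
  obtain g where g: "bij_betw g {..<?n} B"
    using ex_bij_betw_nat_finite[OF fin] B(4) by (auto simp: atLeast0LessThan)
  define h where "h = the_inv_into {..<?n} g"
  have hg: "h (g j) = j" if "j < ?n" for j
    unfolding h_def using that g by (simp add: bij_betw_def the_inv_into_f_f)
  have sumB: "(\<Sum>b\<in>B. w (h b) *s b) = (\<Sum>j<?n. w j *s g j)" for w :: "nat \<Rightarrow> 'a"
    using sum.reindex_bij_betw[OF g, of "\<lambda>b. w (h b) *s b"] by (simp add: hg)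
  let ?F = "\<lambda>x. \<Sum>j<?n. x j *s g j"
  have "inj_on ?F ({..<?n} \<rightarrow>\<^sub>E UNIV)"
  proof (rule inj_onI)
    fix x y :: "nat \<Rightarrow> 'a"
    assume xy: "x \<in> {..<?n} \<rightarrow>\<^sub>E UNIV" "y \<in> {..<?n} \<rightarrow>\<^sub>E UNIV" "?F x = ?F y"
    have "(\<Sum>j<?n. (x j - y j) *s g j) = 0"
      by (simp only: vec.scale_left_diff_distrib sum_subtractf xy(3) diff_self)
    then have comb: "(\<Sum>b\<in>B. (x (h b) - y (h b)) *s b) = 0" using sumB[of "\<lambda>j. x j - y j"] by (simp only:)
    have dep: "vec.dependent B" if "b \<in> B" "x (h b) - y (h b) \<noteq> 0" for b
      unfolding vec.dependent_finite[OF fin]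
      by (intro exI[of _ "\<lambda>b. x (h b) - y (h b)"] conjI bexI[of _ b]) (fact that comb)+
    have 0: "x (h b) - y (h b) = 0" if "b \<in> B" for b
      using dep[OF that] B(2) by blast
    have "x j = y j" if "j < ?n" for j
      using 0[of "g j"] bij_betwE[OF g] hg[OF that] that by simp
    then show "x = y" using xy(1,2) by (intro PiE_ext) auto
  qed
  moreover have "?F ` ({..<?n} \<rightarrow>\<^sub>E UNIV) = V"
  proof
    show "?F ` ({..<?n} \<rightarrow>\<^sub>E UNIV) \<subseteq> V"
    proof (rule image_subsetI)
      fix x :: "nat \<Rightarrow> 'a"
      have "g j \<in> V" if "j < ?n" for j using bij_betwE[OF g] B(1) that by blast
      then show "?F x \<in> V" using V by (intro vec.subspace_sum vec.subspace_scale) auto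
    qed
    show "V \<subseteq> ?F ` ({..<?n} \<rightarrow>\<^sub>E UNIV)"
    proof
      fix v assume "v \<in> V"
      then have "v \<in> range (\<lambda>w. \<Sum>b\<in>B. w b *s b)" using span vec.span_finite[OF fin] by simp
      then obtain w where w: "v = (\<Sum>b\<in>B. w b *s b)" by auto
      have "?F (restrict (\<lambda>j. w (g j)) {..<?n}) = (\<Sum>j<?n. w (g j) *s g j)"
        by (intro sum.cong) auto
      also have "\<dots> = v" using w sum.reindex_bij_betw[OF g, of "\<lambda>b. w b *s b"] by simp
      finally have "v = ?F (restrict (\<lambda>j. w (g j)) {..<?n})" by (rule sym)
      then show "v \<in> ?F ` ({..<?n} \<rightarrow>\<^sub>E UNIV)"
        by (rule image_eqI[where f = ?F and x = "restrict (\<lambda>j. w (g j)) {..<?n}"]) simp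
    qed
  qed
  ultimately show ?thesis unfolding bij_betw_def by blast
qed

lemma num_zeros_parametrized:
  fixes V :: "('a::field ^ 'n::finite) set"
  assumes "bij_betw F X V"
  shows "num_zeros r f ((+) u ` V) = card {x \<in> X. \<forall>l\<in>{1..r}. mpoly_eval (f l) (u + F x) = 0}"
proof -
  let ?G = "\<lambda>x. u + F x"
  have "inj_on ?G X" using assms by (auto simp: bij_betw_def inj_on_def)
  then have inj: "inj_on ?G {x \<in> X. \<forall>l\<in>{1..r}. mpoly_eval (f l) (?G x) = 0}"
    by (rule inj_on_subset) auto
  have "(+) u ` V = ?G ` X" using assms by (auto simp: bij_betw_def)
  then have "{y \<in> (+) u ` V. \<forall>l\<in>{1..r}. mpoly_eval (f l) y = 0} =
      ?G ` {x \<in> X. \<forall>l\<in>{1..r}. mpoly_eval (f l) (?G x) = 0}" by auto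
  then show ?thesis unfolding num_zeros_def using card_image[OF inj] by simp
qed

theorem theorem1:
  fixes f :: "nat \<Rightarrow> ('n::finite, 'a::{field,finite}) mpoly"
    and r d :: nat
    and L1 L2 :: "('a ^ 'n) set"
  assumes "d = (\<Sum>i=1..r. total_degree (f i))"
    and "affine_subspace L1" and "affine_subspace L2"
    and "parallel L1 L2"
    and "d \<le> affine_dimension L1" and "d \<le> affine_dimension L2"
  shows "[num_zeros r f L1 = num_zeros r f L2] (mod CARD('a))"
proof -
  obtain a V where V: "vec.subspace V" "L1 = (+) a ` V"
    using assms(2) unfolding affine_subspace_def by blast
  obtain t where "L2 = (+) t ` L1" using assms(4) unfolding parallel_def by blast
  \<comment> \<open>Both flats are translates of the same \<open>V\<close>, so one parametrization
    serves for both.\<close>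
  then have L2: "L2 = (+) (t + a) ` V" using V(2) by (auto simp: image_image add.assoc)
  define n where "n = vec.dim V"
  have n: "(\<Sum>i\<in>{1..r}. total_degree (f i)) \<le> n"
    using assms(1,5) V unfolding affine_dimension_def n_def by (simp add: direction_translate)
  obtain g where "bij_betw (\<lambda>x. \<Sum>j<n. x j *s g j) ({..<n} \<rightarrow>\<^sub>E UNIV) V"
    using subspace_parametrization[OF V(1)] unfolding n_def by blast
  note count = num_zeros_parametrized[OF this, of r f]
  define \<phi> where "\<phi> u l x = mpoly_eval (f l) (u + (\<Sum>j<n. x j *s g j))" for u l x
  \<comment> \<open>A common support \<open>A\<close> for both translates is what
    \<open>card_zeros_cong_if_top_eq\<close> asks for.\<close>
  define P where "P l A c c' \<longleftrightarrow> finite A \<and> (\<forall>m\<in>A. (\<Sum>i<n. m i) \<le> total_degree (f l)) \<and>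
      (\<forall>m\<in>A. (\<Sum>i<n. m i) = total_degree (f l) \<longrightarrow> c m = c' m) \<and>
      (\<forall>x. \<phi> a l x = (\<Sum>m\<in>A. c m * (\<Prod>i<n. x i ^ m i))) \<and>
      (\<forall>x. \<phi> (t + a) l x = (\<Sum>m\<in>A. c' m * (\<Prod>i<n. x i ^ m i)))" for l A c c'
  have "\<exists>A c c'. P l A c c'" for l
    unfolding P_def \<phi>_def by (rule same_top_explicit[OF same_top_mpoly_eval])
  then obtain A c c' where P: "P l (A l) (c l) (c' l)" for l by metis
  obtain e where "CARD('a) = CHAR('a) ^ e" using card_field_power_CHAR by blast
  then interpret finite_field_card "TYPE('a)" "CHAR('a)" e by unfold_locales simp_all
  have "[card {x \<in> {..<n} \<rightarrow>\<^sub>E UNIV. \<forall>l\<in>{1..r}. (\<Sum>m\<in>A l. c l m * (\<Prod>i<n. x i ^ m i)) = 0} =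
      card {x \<in> {..<n} \<rightarrow>\<^sub>E UNIV. \<forall>l\<in>{1..r}. (\<Sum>m\<in>A l. c' l m * (\<Prod>i<n. x i ^ m i)) = 0}] (mod CARD('a))"
    by (rule card_zeros_cong_if_top_eq[OF _ _ n]) (use P in \<open>auto simp: P_def\<close>)
  moreover have "\<phi> a l x = (\<Sum>m\<in>A l. c l m * (\<Prod>i<n. x i ^ m i))"
    and "\<phi> (t + a) l x = (\<Sum>m\<in>A l. c' l m * (\<Prod>i<n. x i ^ m i))" for l x
    using P[of l] unfolding P_def by blast+
  ultimately show ?thesis
    unfolding V(2) L2 count \<phi>_def[symmetric] by simp
qed

end
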